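(* Assume the setting described in the context. Let $\mathbf{x}=\mathbf{A}^{-1}\mathbf{b}$, and assume that the error propagation matrix $\mathbf{E}$ of the exV-cycle method satisfies $\|\mathbf{E}\|_{\mathbf{A}}<1$. Let $n_{\mathrm{it}}\ge1$ be a number of iterations, let $\mathbf{x}^{(n_{\mathrm{it}})}_{\mathrm{ex}}$ be the approximation computed after $n_{\mathrm{it}}$ iterations of the exV-cycle method starting from an approximation $\mathbf{x}^{(0)}$, and let $\mathbf{x}^{(n_{\mathrm{it}})}_{\mathrm{in}}$ be the approximation computed after $n_{\mathrm{it}}$ iterations of the inV-cycle method starting from the same $\mathbf{x}^{(0)}$. Assume that the errors $\mathbf{v}_0^{(k)}-\mathbf{v}_{0,\mathrm{in}}^{(k)}$ of the coarsest-level solver in the inV-cycle iterations satisfy $$\|\mathbf{v}_0^{(k)}-\mathbf{v}_{0,\mathrm{in}}^{(k)}\|_{\mathbf{A}_0}\le\epsilon,\qquad k=1,\dots,n_{\mathrm{it}},$$ for a constant $\epsilon>0$. Then $$\|\mathbf{x}^{(n_{\mathrm{it}})}_{\mathrm{ex}}-\mathbf{x}^{(n_{\mathrm{it}})}_{\mathrm{in}}\|_{\mathbf{A}}\le\frac{\epsilon\,\|\mathbf{S}\|_{\mathbf{A}_0,\mathbf{A}}}{1-\|\mathbf{E}\|_{\mathbf{A}}},$$ where the matrix $\mathbf{S}$ (defined in the context) satisfies $\|\mathbf{S}\|_{\mathbf{A}_0,\mathbf{A}}\le1$. Moreover, $$\|\mathbf{x}-\mathbf{x}^{(n_{\mathr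m{it}})}_{\mathrm{in}}\|_{\mathbf{A}}\le\|\mathbf{x}-\mathbf{x}^{(n_{\mathrm{it}})}_{\mathrm{ex}}\|_{\mathbf{A}}+\frac{\epsilon\,\|\mathbf{S}\|_{\mathbf{A}_0,\mathbf{A}}}{1-\|\mathbf{E}\|_{\mathbf{A}}}.$$
   Context: Setting. $\mathbf{A}\in\mathbb{R}^{n\times n}$ is symmetric positive definite (SPD) and $\mathbf{b}\in\mathbb{R}^n$. There are $J+1$ levels $0,\dots,J$ ($J\ge1$; level $0$ is the coarsest, level $J$ the finest), with system matrices $\mathbf{A}_j\in\mathbb{R}^{n_j\times n_j}$, $n_J=n$, $\mathbf{A}_J=\mathbf{A}$, and prolongation matrices $\mathbf{P}_j\in\mathbb{R}^{n_j\times n_{j-1}}$, $j=1,\dots,J$, of full (column) rank, satisfying the Galerkin condition $\mathbf{A}_{j-1}=\mathbf{P}_j^\top\mathbf{A}_j\mathbf{P}_j$ for $j=1,\dots,J$ (so all $\mathbf{A}_j$ are SPD). $\mathbf{I}_j\in\mathbb{R}^{n_j\times n_j}$ is the identity. Norms. $\|\cdot\|$ is the Euclidean norm, $\|\mathbf{v}\|_{\mathbf{A}_j}=\|\mathbf{A}_j^{1/2}\mathbf{v}\|$; the same symbols denote the induced matrix norms. For $\mathbf{S}\in\mathbb{R}^{n_J\times n_0}$, $\|\mathbf{S}\|_{\mathbf{A}_0,\mathbf{A}}=\max_{\mathbf{v}\in\mathbb{R}^{n_0},\,\mathbf{v}\ne\mathbf{0}}\|\mathbf{S}\mathbf{v}\|_{\mathbf{A}}/\|\mathbf{v}\|_{\mathbf{A}_0}$.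 Smoothers. $\mathbf{M}_j,\mathbf{N}_j\in\mathbb{R}^{n_j\times n_j}$, $j=1,\dots,J$, are non-singular matrices (not necessarily symmetric) with $\|\mathbf{I}_j-\mathbf{M}_j\mathbf{A}_j\|_{\mathbf{A}_j}<1$ and $\|\mathbf{I}_j-\mathbf{N}_j\mathbf{A}_j\|_{\mathbf{A}_j}<1$. Also allowed: no pre-smoothing (all $\mathbf{M}_j=\mathbf{0}$, with the $\mathbf{N}_j$ non-singular and satisfying $\|\mathbf{I}_j-\mathbf{N}_j\mathbf{A}_j\|_{\mathbf{A}_j}<1$) or no post-smoothing (all $\mathbf{N}_j=\mathbf{0}$, with the $\mathbf{M}_j$ non-singular and satisfying $\|\mathbf{I}_j-\mathbf{M}_j\mathbf{A}_j\|_{\mathbf{A}_j}<1$). V-cycle. One iteration maps $\mathbf{x}^{\mathrm{prev}}$ to $\mathbf{x}^{\mathrm{new}}=\mathbf{V}(\mathbf{b},\mathbf{x}^{\mathrm{prev}},J)$, where $\mathbf{V}(\mathbf{f}_j,\mathbf{v}_j^{[0]},j)$ is defined recursively. For $j\ne0$: $\mathbf{v}_j^{[1]}=\mathbf{v}_j^{[0]}+\mathbf{M}_j(\mathbf{f}_j-\mathbf{A}_j\mathbf{v}_j^{[0]})$; $\mathbf{f}_{j-1}=\mathbf{P}_j^\top(\mathbf{f}_j-\mathbf{A}_j\mathbf{v}_j^{[1]})$; $\mathbf{v}_{j-1}^{[2]}=\mathbf{V}(\mathbf{f}_{j-1},\mathbf{0},j-1)$; $\mathbf{v}_j^{[3]}=\mathbf{v}_j^{[1]}+\mathbf{P}_j\mathbf{v}_{j-1}^{[2]}$;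 $\mathbf{v}_j^{[4]}=\mathbf{v}_j^{[3]}+\mathbf{N}_j(\mathbf{f}_j-\mathbf{A}_j\mathbf{v}_j^{[3]})$; return $\mathbf{v}_j^{[4]}$. For $j=0$: return an exact or approximate solution of $\mathbf{A}_0\mathbf{v}_0=\mathbf{f}_0$. In the exV-cycle method the exact solution $\mathbf{A}_0^{-1}\mathbf{f}_0$ is returned; in the inV-cycle method an approximation in $\mathbb{R}^{n_0}$, computed by an arbitrary (possibly nonlinear) solver, is returned. All other computations are exact. In the $k$th iteration of the inV-cycle method (computing $\mathbf{x}_{\mathrm{in}}^{(k)}$ from $\mathbf{x}_{\mathrm{in}}^{(k-1)}$, with $\mathbf{x}_{\mathrm{in}}^{(0)}=\mathbf{x}^{(0)}$), $\mathbf{v}_0^{(k)}=\mathbf{A}_0^{-1}\mathbf{f}_0^{(k)}$ is the exact solution of the coarsest-level problem with the right-hand side $\mathbf{f}_0^{(k)}$ arising in that iteration, and $\mathbf{v}_{0,\mathrm{in}}^{(k)}$ is the computed approximation that is used. Error propagation matrix. $\mathbf{E}\in\mathbb{R}^{n\times n}$ is the matrix, independent of $\mathbf{b}$ and $\mathbf{x}^{\mathrm{prev}}$, for which one exV-cycle iteration (result $\mathbf{x}^{\mathrm{new}}_{\mathrm{ex}}$) satisfies $\mathbf{x}-\mathbf{x}^{\mathrm{new}}_{\mathrm{ex}}=\mathbf{E}(\mathbf{x}-\mathbf{x}^{\mathrm{prev}})$ for all $\mathbf{b}$ and $\mathbf{x}^{\mathrm{prev}}$, with $\mathbf{x}=\mathbf{A}^{-1}\mathbf{b}$.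 Matrix $\mathbf{S}$. $\mathbf{S}=(\mathbf{I}_J-\mathbf{N}_J\mathbf{A}_J)\mathbf{P}_J\cdots(\mathbf{I}_1-\mathbf{N}_1\mathbf{A}_1)\mathbf{P}_1\in\mathbb{R}^{n_J\times n_0}$. *)

theory Defs
  imports
    Complex_Main
    "Jordan_Normal_Form.Matrix"
    "Jordan_Normal_Form.Gauss_Jordan_Elimination"
    "Jordan_Normal_Form.DL_Rank"
begin

section \<open>Norms\<close>

definition spd :: "real mat \<Rightarrow> bool" where
  "spd A \<longleftrightarrow> square_mat A \<and> transpose_mat A = A \<and>
     (\<forall>v\<in>carrier_vec (dim_row A). v \<noteq> 0\<^sub>v (dim_row A) \<longrightarrow> v \<bullet> (A *\<^sub>v v) > 0)"

definition euclidean_norm :: "real vec \<Rightarrow> real" where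
  "euclidean_norm v = sqrt (v \<bullet> v)"

text \<open>The square root of an SPD matrix is its unique SPD square root, so \<open>SOME\<close> leaves no freedom.\<close>

definition spd_sqrt :: "real mat \<Rightarrow> real mat" where
  "spd_sqrt A = (SOME B. B \<in> carrier_mat (dim_row A) (dim_row A) \<and> spd B \<and> B * B = A)"

definition energy_norm :: "real mat \<Rightarrow> real vec \<Rightarrow> real" where
  "energy_norm A v = euclidean_norm (spd_sqrt A *\<^sub>v v)"

text \<open>The norm of \<open>S\<close> as an operator from the energy norm of \<open>A\<close> to the energy norm of \<open>B\<close>.
  For \<open>A\<close>, \<open>B\<close> SPD of positive order and \<open>S\<close> of matching size, the supremum is attained and so
  is the maximum of these quotients.\<close>

definition induced_norm :: "real mat \<Rightarrow> real mat \<Rightarrow> real mat \<Rightarrow> real" where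
  "induced_norm A B S =
     (SUP v \<in> carrier_vec (dim_col S) - {0\<^sub>v (dim_col S)}. energy_norm B (S *\<^sub>v v) / energy_norm A v)"


section \<open>The V-cycle\<close>

definition convergent_smoother :: "real mat \<Rightarrow> real mat \<Rightarrow> bool" where
  "convergent_smoother A M \<longleftrightarrow>
     invertible_mat M \<and> induced_norm A A (1\<^sub>m (dim_row A) - M * A) < 1"

text \<open>One smoothing step; used with \<open>M\<^sub>j\<close> for pre- and with \<open>N\<^sub>j\<close> for post-smoothing.\<close>

definition smooth :: "real mat \<Rightarrow> real mat \<Rightarrow> real vec \<Rightarrow> real vec \<Rightarrow> real vec" where
  "smooth A M f v = v + M *\<^sub>v (f - A *\<^sub>v v)"

definition restricted_residual :: "real mat \<Rightarrow> real mat \<Rightarrow> real vec \<Rightarrow> real vec \<Rightarrow> real vec" where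
  "restricted_residual A P f v = transpose_mat P *\<^sub>v (f - A *\<^sub>v v)"

definition exact_solve :: "real mat \<Rightarrow> real vec \<Rightarrow> real vec" where
  "exact_solve A f = the (mat_inverse A) *\<^sub>v f"

text \<open>The parameter \<open>C\<close> is the solver on the coarsest level: a map from right-hand sides to
  computed solutions.\<close>

fun vcycle :: "(nat \<Rightarrow> real mat) \<Rightarrow> (nat \<Rightarrow> real mat) \<Rightarrow> (nat \<Rightarrow> real mat) \<Rightarrow> (nat \<Rightarrow> real mat) \<Rightarrow>
    (real vec \<Rightarrow> real vec) \<Rightarrow> nat \<Rightarrow> real vec \<Rightarrow> real vec \<Rightarrow> real vec" where
  "vcycle A P M N C 0 f v = C f"
| "vcycle A P M N C (Suc j) f v =
    (let v1 = smooth (A (Suc j)) (M (Suc j)) f v;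
         f' = restricted_residual (A (Suc j)) (P (Suc j)) f v1;
         v2 = vcycle A P M N C j f' (0\<^sub>v (dim_row (A j)));
         v3 = v1 + P (Suc j) *\<^sub>v v2
     in smooth (A (Suc j)) (N (Suc j)) f v3)"

text \<open>The right-hand side that \<open>vcycle\<close> passes to the coarsest-level solver. It is computed on the
  way down and hence depends neither on that solver nor on the post-smoothers.\<close>

fun coarsest_rhs :: "(nat \<Rightarrow> real mat) \<Rightarrow> (nat \<Rightarrow> real mat) \<Rightarrow> (nat \<Rightarrow> real mat) \<Rightarrow>
    nat \<Rightarrow> real vec \<Rightarrow> real vec \<Rightarrow> real vec" where
  "coarsest_rhs A P M 0 f v = f"
| "coarsest_rhs A P M (Suc j) f v =
    (let v1 = smooth (A (Suc j)) (M (Suc j)) f v;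
         f' = restricted_residual (A (Suc j)) (P (Suc j)) f v1
     in coarsest_rhs A P M j f' (0\<^sub>v (dim_row (A j))))"

text \<open>The approximation after \<open>k\<close> iterations started from \<open>x0\<close>. The coarsest-level solver may vary
  with the iteration: \<open>C k\<close> is the one used in the \<open>k\<close>-th iteration, counted from 1.\<close>

fun vcycle_iterate :: "(nat \<Rightarrow> real mat) \<Rightarrow> (nat \<Rightarrow> real mat) \<Rightarrow> (nat \<Rightarrow> real mat) \<Rightarrow> (nat \<Rightarrow> real mat) \<Rightarrow>
    (nat \<Rightarrow> real vec \<Rightarrow> real vec) \<Rightarrow> nat \<Rightarrow> real vec \<Rightarrow> real vec \<Rightarrow> nat \<Rightarrow> real vec" where
  "vcycle_iterate A P M N C J b x0 0 = x0"
| "vcycle_iterate A P M N C J b x0 (Suc k) =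
    vcycle A P M N (C (Suc k)) J b (vcycle_iterate A P M N C J b x0 k)"

definition exV_iterate :: "(nat \<Rightarrow> real mat) \<Rightarrow> (nat \<Rightarrow> real mat) \<Rightarrow> (nat \<Rightarrow> real mat) \<Rightarrow>
    (nat \<Rightarrow> real mat) \<Rightarrow> nat \<Rightarrow> real vec \<Rightarrow> real vec \<Rightarrow> nat \<Rightarrow> real vec" where
  "exV_iterate A P M N J = vcycle_iterate A P M N (\<lambda>_. exact_solve (A 0)) J"

definition error_propagation_matrix :: "(nat \<Rightarrow> real mat) \<Rightarrow> (nat \<Rightarrow> real mat) \<Rightarrow>
    (nat \<Rightarrow> real mat) \<Rightarrow> (nat \<Rightarrow> real mat) \<Rightarrow> nat \<Rightarrow> real mat" where
  "error_propagation_matrix A P M N J =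
    (THE E. E \<in> carrier_mat (dim_row (A J)) (dim_row (A J)) \<and>
       (\<forall>b\<in>carrier_vec (dim_row (A J)). \<forall>xprev\<in>carrier_vec (dim_row (A J)).
          exact_solve (A J) b - vcycle A P M N (exact_solve (A 0)) J b xprev
          = E *\<^sub>v (exact_solve (A J) b - xprev)))"

text \<open>\<open>coarse_to_fine A P N J\<close> is the matrix \<open>S\<close>, the product
  \<open>(I\<^sub>J - N\<^sub>J A\<^sub>J) P\<^sub>J \<cdots> (I\<^sub>1 - N\<^sub>1 A\<^sub>1) P\<^sub>1\<close>.\<close>

fun coarse_to_fine :: "(nat \<Rightarrow> real mat) \<Rightarrow> (nat \<Rightarrow> real mat) \<Rightarrow> (nat \<Rightarrow> real mat) \<Rightarrow> nat \<Rightarrow> real mat" where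
  "coarse_to_fine A P N 0 = 1\<^sub>m (dim_row (A 0))"
| "coarse_to_fine A P N (Suc j) =
    (1\<^sub>m (dim_row (A (Suc j))) - N (Suc j) * A (Suc j)) * P (Suc j) * coarse_to_fine A P N j"

end

theory Submission
  imports
    Defs
    "Jordan_Normal_Form.Spectral_Radius"
    "HOL-Analysis.L2_Norm"
begin

text \<open>Two V-cycles that differ only in the coarsest-level solver pass the same right-hand side to it,
  so their results differ by \<open>S\<close> applied to the difference of the coarsest-level solutions. With
  \<open>d\<^sub>k\<close> the difference of the exact and inexact iterates this gives
  \<open>d\<^sub>k\<^sub>+\<^sub>1 = E d\<^sub>k + S (v\<^sub>0 - v\<^sub>0\<^sub>,\<^sub>i\<^sub>n)\<close>, and the bound follows by summing a geometric series.
  Prolongations are isometries for the energy norms by the Galerkin condition and the smoothers do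
  not increase the energy norm, hence \<open>\<parallel>S\<parallel> \<le> 1\<close>.\<close>

section \<open>Square roots of SPD matrices\<close>

text \<open>The definitions describe three objects indirectly, and each must be shown to be
  meaningful before it can be used. The energy norm goes through a root picked by
  \<open>SOME\<close>, so the existence of an SPD square root precedes every norm estimate; the
  eigenvector behind it is found over the complex numbers and then shown to be real. The induced
  norm is a supremum of reals, which bounds its members only once the quotients are known to be
  bounded above; a crude matrix estimate supplies that. The matrix \<open>E\<close> is a definite
  description: existence comes from a recursion through the levels, uniqueness from the freedom to
  choose \<open>b\<close> and the starting vector. The coarsest-level solver may be nonlinear, so an
  inexact cycle need not have an error matrix. Hence the comparison inserts an exact cycle started
  from the inexact iterate: next to the exact iteration only the starting vectors differ, which is
  governed by \<open>E\<close>; next to the inexact one only the solvers differ, which is governed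
  by \<open>S\<close>.\<close>

text \<open>The library's associativity laws speak about carriers; with side conditions on dimensions
  the simplifier can discharge them for compound factors, too.\<close>

lemma mat_assoc:
  fixes A :: "'a :: semiring_0 mat"
  assumes "dim_col A = dim_row B" "dim_col B = dim_row C"
  shows "A * B * C = A * (B * C)"
  using assms by (intro assoc_mult_mat[of A "dim_row A" "dim_col A" B "dim_col B" C "dim_col C"]) auto

lemma mat_vec_assoc:
  fixes A :: "'a :: semiring_0 mat"
  assumes "dim_col A = dim_row B" "dim_col B = dim_vec v"
  shows "A * B *\<^sub>v v = A *\<^sub>v (B *\<^sub>v v)"
proof (rule assoc_mult_mat_vec)
  show "A \<in> carrier_mat (dim_row A) (dim_row B)" by (rule carrier_matI) (simp_all only: assms)
  show "B \<in> carrier_mat (dim_row B) (dim_vec v)" by (rule carrier_matI) (simp_all only: assms)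
  show "v \<in> carrier_vec (dim_vec v)" by (rule carrier_vecI) simp
qed

text \<open>\<open>H\<close> is the Householder reflection that exchanges \<open>u\<close> and the first unit vector. If these two
  coincide, then \<open>c = 0\<close>, and \<open>2 / 0 = 0\<close> makes \<open>H\<close> the identity.\<close>

lemma orthogonal_completion:
  fixes u :: "nat \<Rightarrow> real"
  assumes u: "(\<Sum>i<n. u i * u i) = 1" and n: "0 < n"
  obtains H :: "nat \<Rightarrow> nat \<Rightarrow> real" where
    "\<And>i. i < n \<Longrightarrow> H i 0 = u i"
    "\<And>i j. i < n \<Longrightarrow> j < n \<Longrightarrow> (\<Sum>k<n. H i k * H j k) = of_bool (i = j)"
    "\<And>i j. i < n \<Longrightarrow> j < n \<Longrightarrow> (\<Sum>k<n. H k i * H k j) = of_bool (i = j)"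
proof -
  define w where "w i = u i - of_bool (i = 0)" for i
  define c where "c = (\<Sum>i<n. w i * w i)"
  define a where "a = 2 / c"
  define H where "H i j = of_bool (i = j) - a * w i * w j" for i j
  have delta: "(\<Sum>k<n. of_bool (i = k) * g k) = g i" if "i < n" for i and g :: "nat \<Rightarrow> real"
    using that by simp
  have c: "c = 2 - 2 * u 0"
  proof -
    have "c = (\<Sum>i<n. u i * u i - 2 * (of_bool (0 = i) * u i) + of_bool (0 = i) * 1)"
      unfolding c_def w_def
    proof (rule sum.cong)
      show "(u i - of_bool (i = 0)) * (u i - of_bool (i = 0))
        = u i * u i - 2 * (of_bool (0 = i) * u i) + of_bool (0 = i) * 1" for i
        by (cases "i = 0") (simp_all add: algebra_simps)
    qed simp
    also have "\<dots> = (\<Sum>i<n. u i * u i) - 2 * (\<Sum>i<n. of_bool (0 = i) * u i) + (\<Sum>i<n. of_bool (0 = i) * 1)"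
      by (simp only: sum.distrib sum_subtractf sum_distrib_left)
    also have "\<dots> = 2 - 2 * u 0" unfolding u delta[OF n] by simp
    finally show ?thesis .
  qed
  have w0: "w i = 0" if "c = 0" "i < n" for i
    using that unfolding c_def by (subst (asm) sum_nonneg_eq_0_iff) auto
  have "H i 0 = u i" if "i < n" for i
  proof (cases "c = 0")
    case True
    then have "w i = 0" "w 0 = 0" using w0 that n by auto
    then have "H i 0 = of_bool (i = 0)" "u i = of_bool (i = 0)" unfolding H_def w_def by auto
    then show ?thesis by simp
  next
    case False
    \<comment> \<open>Here \<open>w 0 = u 0 - 1\<close> and \<open>c = 2 - 2 * u 0\<close>, that is
      \<open>c = - 2 * w 0\<close>.\<close>
    have "a * w 0 = - 1" using False c by (simp add: a_def w_def field_simps)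
    have "H i 0 = of_bool (i = 0) - (a * w 0) * w i" unfolding H_def by simp
    also have "\<dots> = u i" unfolding \<open>a * w 0 = - 1\<close> by (simp add: w_def)
    finally show ?thesis .
  qed
  moreover have HH: "(\<Sum>k<n. H i k * H j k) = of_bool (i = j)" if "i < n" "j < n" for i j
  proof -
    have "(\<Sum>k<n. H i k * H j k) = (\<Sum>k<n. of_bool (i = k) * of_bool (j = k)
        - a * w j * (of_bool (i = k) * w k) - a * w i * (of_bool (j = k) * w k)
        + a * a * w i * w j * (w k * w k))"
      unfolding H_def
    proof (rule sum.cong)
      show "(of_bool (i = k) - a * w i * w k) * (of_bool (j = k) - a * w j * w k)
        = of_bool (i = k) * of_bool (j = k) - a * w j * (of_bool (i = k) * w k)
        - a * w i * (of_bool (j = k) * w k) + a * a * w i * w j * (w k * w k)" for k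
        by (cases "i = k"; cases "j = k") (simp_all add: algebra_simps)
    qed simp
    also have "\<dots> = (\<Sum>k<n. of_bool (i = k) * of_bool (j = k))
        - a * w j * (\<Sum>k<n. of_bool (i = k) * w k) - a * w i * (\<Sum>k<n. of_bool (j = k) * w k)
        + a * a * w i * w j * c"
      by (simp only: sum.distrib sum_subtractf sum_distrib_left c_def)
    also have "\<dots> = of_bool (j = i) + (a * a * c - 2 * a) * w i * w j"
      unfolding delta[OF that(1)] delta[OF that(2)] by (simp add: algebra_simps)
    \<comment> \<open>True for \<open>c = 0\<close> as well, because then \<open>a = 0\<close>;
      orthogonality thus needs no case distinction.\<close>
    also have "a * a * c = 2 * a" unfolding a_def by simp
    finally show ?thesis by (cases "i = j") auto
  qed
  \<comment> \<open>By this symmetry the orthonormality of the rows is also that of the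
    columns.\<close>
  moreover have "H i j = H j i" for i j by (cases "i = j") (simp_all add: H_def)
  ultimately show thesis by (intro that[of H]) auto
qed

section \<open>Symmetric matrices: existence of a real eigenvector\<close>

lemma symmetric_scalar_prod:
  fixes A :: "'a :: comm_semiring_0 mat"
  assumes A: "A \<in> carrier_mat n n" and sym: "transpose_mat A = A"
    and v: "v \<in> carrier_vec n" and w: "w \<in> carrier_vec n"
  shows "v \<bullet> (A *\<^sub>v w) = w \<bullet> (A *\<^sub>v v)"
proof -
  have "v \<bullet> (A *\<^sub>v w) = (A *\<^sub>v w) \<bullet> v"
    using A v w by (intro comm_scalar_prod) auto
  also have "\<dots> = w \<bullet> (A *\<^sub>v v)"
    using transpose_vec_mult_scalar[OF A v w] sym by simp
  finally show ?thesis .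
qed

lemma scalar_prod_self_pos:
  fixes v :: "real vec"
  assumes "v \<in> carrier_vec n" "v \<noteq> 0\<^sub>v n"
  shows "v \<bullet> v > 0"
  using conjugate_square_greater_0_vec[OF assms(1)] assms by simp

text \<open>A complex eigenvector \<open>z\<close> with eigenvalue \<open>\<mu>\<close> exists in
  every positive dimension. Write \<open>z\<close> as \<open>x\<close> plus i times
  \<open>y\<close>. Symmetry equates the product of \<open>x\<close> with \<open>A y\<close> and
  that of \<open>y\<close> with \<open>A x\<close>, and the difference of the two is
  \<open>Im \<mu>\<close> times the squared length of \<open>z\<close>. Hence \<open>\<mu>\<close>
  is real, and a nonzero one among \<open>x\<close> and \<open>y\<close> can be normalised.\<close>

lemma symmetric_unit_eigenvector:
  fixes A :: "real mat"
  assumes A: "A \<in> carrier_mat n n" and sym: "transpose_mat A = A" and n: "0 < n"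
  obtains u and l :: real where "u \<in> carrier_vec n" "u \<bullet> u = 1" "A *\<^sub>v u = l \<cdot>\<^sub>v u"
proof -
  let ?Ac = "map_mat complex_of_real A"
  have Ac: "?Ac \<in> carrier_mat n n" using A by simp
  obtain z \<mu> where z: "z \<in> carrier_vec n" "z \<noteq> 0\<^sub>v n" and ev: "?Ac *\<^sub>v z = \<mu> \<cdot>\<^sub>v z"
    using spectrum_non_empty[OF Ac n] A
    by (auto simp: spectrum_def eigenvalue_def eigenvector_def)
  define x y where "x = map_vec Re z" and "y = map_vec Im z"
  have x: "x \<in> carrier_vec n" and y: "y \<in> carrier_vec n" using z by (auto simp: x_def y_def)
  have comp: "(\<Sum>j<n. complex_of_real (A $$ (i, j)) * z $ j) = \<mu> * z $ i" if "i < n" for i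
  proof -
    have "(?Ac *\<^sub>v z) $ i = (\<mu> \<cdot>\<^sub>v z) $ i" using ev by simp
    then show ?thesis using that A z by (simp add: scalar_prod_def atLeast0LessThan)
  qed
  have Ax: "A *\<^sub>v x = Re \<mu> \<cdot>\<^sub>v x - Im \<mu> \<cdot>\<^sub>v y"
  proof (rule eq_vecI)
    fix i assume "i < dim_vec (Re \<mu> \<cdot>\<^sub>v x - Im \<mu> \<cdot>\<^sub>v y)"
    then have i: "i < n" using y by simp
    have "(A *\<^sub>v x) $ i = Re (\<Sum>j<n. complex_of_real (A $$ (i, j)) * z $ j)"
      using i A z by (simp add: scalar_prod_def atLeast0LessThan x_def)
    then show "(A *\<^sub>v x) $ i = (Re \<mu> \<cdot>\<^sub>v x - Im \<mu> \<cdot>\<^sub>v y) $ i"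
      using i z unfolding comp[OF i] by (simp add: x_def y_def)
  qed (use A y in auto)
  have Ay: "A *\<^sub>v y = Re \<mu> \<cdot>\<^sub>v y + Im \<mu> \<cdot>\<^sub>v x"
  proof (rule eq_vecI)
    fix i assume "i < dim_vec (Re \<mu> \<cdot>\<^sub>v y + Im \<mu> \<cdot>\<^sub>v x)"
    then have i: "i < n" using x by simp
    have "(A *\<^sub>v y) $ i = Im (\<Sum>j<n. complex_of_real (A $$ (i, j)) * z $ j)"
      using i A z by (simp add: scalar_prod_def atLeast0LessThan y_def)
    then show "(A *\<^sub>v y) $ i = (Re \<mu> \<cdot>\<^sub>v y + Im \<mu> \<cdot>\<^sub>v x) $ i"
      using i z unfolding comp[OF i] by (simp add: x_def y_def)
  qed (use A x in auto)
  have xy: "x \<noteq> 0\<^sub>v n \<or> y \<noteq> 0\<^sub>v n"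
  proof (rule ccontr)
    assume "\<not> ?thesis"
    then have 0: "x = 0\<^sub>v n" "y = 0\<^sub>v n" by auto
    have "z $ i = 0" if "i < n" for i
    proof -
      have "x $ i = 0" "y $ i = 0" using that 0 by auto
      then show ?thesis using that z by (simp add: x_def y_def complex_eq_iff)
    qed
    then have "z = 0\<^sub>v n" using z by (intro eq_vecI) auto
    then show False using z by simp
  qed
  have "Im \<mu> * (x \<bullet> x + y \<bullet> y) = 0"
  proof -
    have "x \<bullet> (A *\<^sub>v y) = y \<bullet> (A *\<^sub>v x)" by (rule symmetric_scalar_prod[OF A sym x y])
    then show ?thesis
      using x y comm_scalar_prod[OF x y] unfolding Ax Ay
      by (simp add: scalar_prod_add_distrib[of _ n] scalar_prod_minus_distrib[of _ n] algebra_simps)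
  qed
  moreover have "x \<bullet> x + y \<bullet> y > 0"
    using xy scalar_prod_self_pos[OF x] scalar_prod_self_pos[OF y] x y
    by (cases "x = 0\<^sub>v n"; cases "y = 0\<^sub>v n") (auto intro: add_pos_pos)
  ultimately have "Im \<mu> = 0" by simp
  \<comment> \<open>With \<open>Im \<mu> = 0\<close> the equations for \<open>x\<close> and
    \<open>y\<close> decouple, so \<open>v\<close> can be whichever of them is nonzero.\<close>
  obtain v where v: "v \<in> carrier_vec n" "v \<noteq> 0\<^sub>v n" "A *\<^sub>v v = Re \<mu> \<cdot>\<^sub>v v"
    using xy x y Ax Ay \<open>Im \<mu> = 0\<close> by fastforce
  let ?u = "(1 / sqrt (v \<bullet> v)) \<cdot>\<^sub>v v"
  have vv: "v \<bullet> v > 0" using scalar_prod_self_pos v by blast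
  show thesis
  proof (rule that)
    show "?u \<in> carrier_vec n" using v by simp
    have "?u \<bullet> ?u = (v \<bullet> v) / (sqrt (v \<bullet> v) * sqrt (v \<bullet> v))" using v by simp
    also have "\<dots> = 1" using vv by (subst real_sqrt_mult_self) auto
    finally show "?u \<bullet> ?u = 1" .
    show "A *\<^sub>v ?u = Re \<mu> \<cdot>\<^sub>v ?u" using A v by (simp add: mult_mat_vec smult_smult_assoc mult.commute)
  qed
qed

section \<open>SPD matrices: congruence and square roots\<close>

lemma spdD:
  assumes "spd A" "A \<in> carrier_mat n n"
  shows "transpose_mat A = A" "\<And>v. v \<in> carrier_vec n \<Longrightarrow> v \<noteq> 0\<^sub>v n \<Longrightarrow> v \<bullet> (A *\<^sub>v v) > 0"
  using assms by (auto simp: spd_def)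

text \<open>The quadratic form of the product at \<open>v\<close> is that of \<open>A\<close> at
  \<open>T v\<close>, and injectivity keeps \<open>T v\<close> away from zero. It serves twice: for
  the compression of a matrix to the complement of an eigenvector, and for the Galerkin
  matrices.\<close>

lemma spd_congruence:
  assumes A: "A \<in> carrier_mat n n" and spd: "spd A" and T: "T \<in> carrier_mat n m"
    and inj: "\<And>v. v \<in> carrier_vec m \<Longrightarrow> T *\<^sub>v v = 0\<^sub>v n \<Longrightarrow> v = 0\<^sub>v m"
  shows "spd (transpose_mat T * A * T)"
proof -
  let ?B = "transpose_mat T * A * T"
  have B: "?B \<in> carrier_mat m m" using A T by simp
  have form: "v \<bullet> (transpose_mat T * A * T *\<^sub>v v) = (T *\<^sub>v v) \<bullet> (A *\<^sub>v (T *\<^sub>v v))"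
    if v: "v \<in> carrier_vec m" for v
  proof -
    have "transpose_mat T * A * T *\<^sub>v v = transpose_mat T *\<^sub>v (A *\<^sub>v (T *\<^sub>v v))"
      using A T v by (simp add: mat_vec_assoc)
    then have "v \<bullet> (transpose_mat T * A * T *\<^sub>v v) = (transpose_mat T *\<^sub>v (A *\<^sub>v (T *\<^sub>v v))) \<bullet> v"
      using A T v by (subst comm_scalar_prod[of _ m]) auto
    also have "\<dots> = (A *\<^sub>v (T *\<^sub>v v)) \<bullet> (T *\<^sub>v v)"
      using A T v by (intro transpose_vec_mult_scalar) auto
    also have "\<dots> = (T *\<^sub>v v) \<bullet> (A *\<^sub>v (T *\<^sub>v v))"
      using A T v by (subst comm_scalar_prod[of _ n]) auto
    finally show ?thesis .
  qed
  have sym: "transpose_mat ?B = ?B"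
  proof -
    have "transpose_mat (transpose_mat T * A * T) = transpose_mat T * transpose_mat (transpose_mat T * A)"
      using A T by (intro transpose_mult) auto
    also have "transpose_mat (transpose_mat T * A) = A * T"
      using transpose_mult[of "transpose_mat T" m n A n] A T spdD(1)[OF spd A] by simp
    also have "transpose_mat T * (A * T) = transpose_mat T * A * T"
      using A T by (intro assoc_mult_mat[symmetric]) auto
    finally show ?thesis .
  qed
  have pos: "0 < (T *\<^sub>v v) \<bullet> (A *\<^sub>v (T *\<^sub>v v))" if "v \<in> carrier_vec m" "v \<noteq> 0\<^sub>v m" for v
    using that inj T by (intro spdD(2)[OF spd A]) auto
  show ?thesis
    unfolding spd_def
  proof (intro conjI ballI impI)
    show "square_mat ?B" using B by auto
    show "transpose_mat ?B = ?B" by (rule sym)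
    fix v :: "real vec" assume "v \<in> carrier_vec (dim_row ?B)" "v \<noteq> 0\<^sub>v (dim_row ?B)"
    then show "0 < v \<bullet> (?B *\<^sub>v v)" using T form pos by simp
  qed
qed

lemma transpose_smult_mat: "transpose_mat (c \<cdot>\<^sub>m A) = c \<cdot>\<^sub>m transpose_mat A"
  by (rule eq_matI) auto

lemma smult_smult_mat: "c \<cdot>\<^sub>m (d \<cdot>\<^sub>m A) = (c * d :: 'a :: semigroup_mult) \<cdot>\<^sub>m A"
  by (rule eq_matI) (auto simp: mult.assoc)

lemma smult_mat_mult_vec:
  fixes A :: "'a :: semiring_0 mat"
  assumes "dim_col A = dim_vec v"
  shows "(c \<cdot>\<^sub>m A) *\<^sub>v v = c \<cdot>\<^sub>v (A *\<^sub>v v)"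
  by (rule eq_vecI) (use assms in \<open>auto simp: scalar_prod_def sum_distrib_left mult.assoc\<close>)

lemma mult_mat_zero_vec:
  fixes A :: "'a :: semiring_0 mat"
  assumes "A \<in> carrier_mat n m"
  shows "A *\<^sub>v 0\<^sub>v m = 0\<^sub>v n"
  by (rule eq_vecI) (use assms in auto)

text \<open>Split off a unit eigenvector \<open>u\<close> with eigenvalue \<open>l\<close>, and let the columns of \<open>T\<close> complete \<open>u\<close> to
  an orthonormal basis. If \<open>C\<close> is a square root of \<open>T\<^sup>T A T\<close>, then \<open>\<surd>l u u\<^sup>T + T C T\<^sup>T\<close> is one of \<open>A\<close>.\<close>

lemma spd_square_root_exists:
  assumes "A \<in> carrier_mat n n" "spd A"
  shows "\<exists>B. B \<in> carrier_mat n n \<and> spd B \<and> B * B = A"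
  using assms
proof (induction n arbitrary: A)
  case 0
  then show ?case by (intro exI[of _ A]) auto
next
  case (Suc k)
  let ?n = "Suc k"
  note A = Suc.prems(1) and spd = Suc.prems(2)
  note sym = spdD(1)[OF spd A]
  obtain u and l :: real where u: "u \<in> carrier_vec ?n" "u \<bullet> u = 1" "A *\<^sub>v u = l \<cdot>\<^sub>v u"
    using symmetric_unit_eigenvector[OF A sym] by auto
  have "u \<noteq> 0\<^sub>v ?n" using u by auto
  then have l: "0 < l" using spdD(2)[OF spd A u(1)] u by simp
  have uu: "(\<Sum>i<?n. u $ i * u $ i) = 1"
    using u by (simp add: scalar_prod_def atLeast0LessThan del: sum.lessThan_Suc)
  obtain H where H0: "\<And>i. i < ?n \<Longrightarrow> H i 0 = u $ i"
    and rows: "\<And>i j. i < ?n \<Longrightarrow> j < ?n \<Longrightarrow> (\<Sum>k<?n. H i k * H j k) = of_bool (i = j)"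
    and cols: "\<And>i j. i < ?n \<Longrightarrow> j < ?n \<Longrightarrow> (\<Sum>k<?n. H k i * H k j) = of_bool (i = j)"
    using orthogonal_completion[OF uu zero_less_Suc] by blast
  \<comment> \<open>Column 0 of \<open>H\<close> is \<open>u\<close> and is left out, hence the
    shift to \<open>Suc j\<close>. \<open>U\<close> is the orthogonal projection onto the span of
    \<open>u\<close>.\<close>
  define T where "T = mat ?n k (\<lambda>(i, j). H i (Suc j))"
  define U where "U = mat ?n ?n (\<lambda>(i, j). u $ i * u $ j)"
  let ?T = "transpose_mat T"
  have T: "T \<in> carrier_mat ?n k" and T': "?T \<in> carrier_mat k ?n" and U: "U \<in> carrier_mat ?n ?n"
    by (auto simp: T_def U_def)
  have TT: "?T * T = 1\<^sub>m k"
    by (rule eq_matI) (use cols in \<open>auto simp: T_def scalar_prod_def atLeast0LessThan simp del: sum.lessThan_Suc\<close>)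
  have TT': "T * ?T = 1\<^sub>m ?n - U"
  proof (rule eq_matI)
    fix i j assume "i < dim_row (1\<^sub>m ?n - U)" "j < dim_col (1\<^sub>m ?n - U)"
    then have ij: "i < ?n" "j < ?n" using U by auto
    have "(T * ?T) $$ (i, j) = (\<Sum>m<k. H i (Suc m) * H j (Suc m))"
      using ij by (simp add: T_def scalar_prod_def atLeast0LessThan)
    also have "\<dots> = (\<Sum>m<?n. H i m * H j m) - H i 0 * H j 0"
      by (simp add: sum.lessThan_Suc_shift del: sum.lessThan_Suc)
    also have "\<dots> = (1\<^sub>m ?n - U) $$ (i, j)"
      using ij by (simp only: rows H0) (simp add: U_def)
    finally show "(T * ?T) $$ (i, j) = (1\<^sub>m ?n - U) $$ (i, j)" .
  qed (use T U in auto)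
  have TU: "?T * U = 0\<^sub>m k ?n"
  proof (rule eq_matI)
    fix i j assume "i < dim_row (0\<^sub>m k ?n :: real mat)" "j < dim_col (0\<^sub>m k ?n :: real mat)"
    then have ij: "i < k" "j < ?n" by auto
    have "(?T * U) $$ (i, j) = (\<Sum>m<?n. H m (Suc i) * (u $ m * u $ j))"
      using ij by (simp add: T_def U_def scalar_prod_def atLeast0LessThan del: sum.lessThan_Suc)
    also have "\<dots> = (\<Sum>m<?n. H m (Suc i) * H m 0) * u $ j"
      unfolding sum_distrib_right by (intro sum.cong) (auto simp: H0)
    also have "\<dots> = 0" using ij by (simp add: cols del: sum.lessThan_Suc)
    finally show "(?T * U) $$ (i, j) = 0\<^sub>m k ?n $$ (i, j)" using ij by simp
  qed (use T U in auto)
  have U_sym: "transpose_mat U = U" by (rule eq_matI) (auto simp: U_def)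
  have UT: "U * T = 0\<^sub>m ?n k"
  proof -
    have "U * T = transpose_mat (?T * U)" unfolding transpose_mult[OF T' U] U_sym by simp
    then show ?thesis unfolding TU by simp
  qed
  have UU: "U * U = U"
  proof (rule eq_matI)
    fix i j assume "i < dim_row U" "j < dim_col U"
    then have ij: "i < ?n" "j < ?n" using U by auto
    have "(U * U) $$ (i, j) = (\<Sum>m<?n. (u $ i * u $ m) * (u $ m * u $ j))"
      using ij by (simp add: U_def scalar_prod_def atLeast0LessThan del: sum.lessThan_Suc)
    also have "\<dots> = u $ i * u $ j * (\<Sum>m<?n. u $ m * u $ m)"
      unfolding sum_distrib_left by (intro sum.cong) auto
    finally show "(U * U) $$ (i, j) = U $$ (i, j)" using ij by (simp only: uu) (simp add: U_def)
  qed (use U in auto)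
  have AU: "A * U = l \<cdot>\<^sub>m U"
  proof (rule eq_matI)
    fix i j assume "i < dim_row (l \<cdot>\<^sub>m U)" "j < dim_col (l \<cdot>\<^sub>m U)"
    then have ij: "i < ?n" "j < ?n" using U by auto
    have "(A * U) $$ (i, j) = (\<Sum>m<?n. A $$ (i, m) * (u $ m * u $ j))"
      using ij A by (simp add: U_def scalar_prod_def atLeast0LessThan del: sum.lessThan_Suc)
    also have "\<dots> = (A *\<^sub>v u) $ i * u $ j"
      using ij A u(1) by (simp add: scalar_prod_def atLeast0LessThan sum_distrib_right mult.assoc del: sum.lessThan_Suc)
    also have "\<dots> = (l \<cdot>\<^sub>m U) $$ (i, j)"
      unfolding u(3) using ij u(1) by (simp add: U_def)
    finally show "(A * U) $$ (i, j) = (l \<cdot>\<^sub>m U) $$ (i, j)" .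
  qed (use A U in auto)
  have UA: "U * A = l \<cdot>\<^sub>m U"
  proof -
    have "U * A = transpose_mat (A * U)" unfolding transpose_mult[OF A U] U_sym sym ..
    then show ?thesis unfolding AU transpose_smult_mat U_sym .
  qed
  have "spd (?T * A * T)"
  proof (rule spd_congruence[OF A spd T])
    fix v assume v: "v \<in> carrier_vec k" "T *\<^sub>v v = 0\<^sub>v ?n"
    have "v = ?T * T *\<^sub>v v" using v TT by simp
    also have "\<dots> = ?T *\<^sub>v (T *\<^sub>v v)" using T T' v by simp
    also have "\<dots> = 0\<^sub>v k" unfolding v(2) by (rule mult_mat_zero_vec[OF T'])
    finally show "v = 0\<^sub>v k" .
  qed
  then obtain C where C: "C \<in> carrier_mat k k" and C_spd: "spd C" and CC: "C * C = ?T * A * T"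
    using Suc.IH[of "?T * A * T"] A T T' by auto
  note C_sym = spdD(1)[OF C_spd C]
  define D where "D = T * C * ?T"
  have D: "D \<in> carrier_mat ?n ?n" using T C by (simp add: D_def)
  \<comment> \<open>The inner factors \<open>?T * T\<close> cancel, and the outer ones are both
    \<open>1 - U\<close>. Since \<open>A * U\<close> and \<open>U * A\<close> both equal
    \<open>l\<close> times \<open>U\<close>, compressing \<open>A\<close> by \<open>1 - U\<close>
    from both sides removes exactly that multiple.\<close>
  have DD: "D * D = A - l \<cdot>\<^sub>m U"
  proof -
    have "D * D = T * (C * (?T * T) * C) * ?T"
      unfolding D_def using T T' C
      by (simp add: mat_assoc)
    also have "\<dots> = T * (?T * A * T) * ?T" unfolding TT using C CC by simp
    also have "\<dots> = (T * ?T) * A * (T * ?T)"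
      using T T' A by (simp add: mat_assoc)
    also have "\<dots> = A - l \<cdot>\<^sub>m U"
    proof -
      have "(1\<^sub>m ?n - U) * A = A - l \<cdot>\<^sub>m U"
        using A U by (simp add: minus_mult_distrib_mat[of _ ?n ?n] UA)
      moreover have "(A - l \<cdot>\<^sub>m U) * (1\<^sub>m ?n - U) = A - l \<cdot>\<^sub>m U"
      proof -
        have lU: "l \<cdot>\<^sub>m U \<in> carrier_mat ?n ?n" using U by simp
        then have X: "A - l \<cdot>\<^sub>m U \<in> carrier_mat ?n ?n" by (rule minus_carrier_mat)
        have "(A - l \<cdot>\<^sub>m U) * U = 0\<^sub>m ?n ?n"
          using lU by (simp add: minus_mult_distrib_mat[OF A lU U] AU mult_smult_assoc_mat[OF U U] UU)
        then show ?thesis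
          unfolding mult_minus_distrib_mat[OF X one_carrier_mat U] right_mult_one_mat[OF X]
          using U by (intro eq_matI) auto
      qed
      ultimately show ?thesis unfolding TT' by simp
    qed
    finally show ?thesis .
  qed
  have UD: "U * D = 0\<^sub>m ?n ?n" and DU: "D * U = 0\<^sub>m ?n ?n"
  proof -
    have "U * D = (U * T) * (C * ?T)" unfolding D_def using U T T' C
      by (simp add: mat_assoc)
    then show "U * D = 0\<^sub>m ?n ?n" unfolding UT using C T' by auto
    have "D * U = T * C * (?T * U)" unfolding D_def using U T T' C
      by (simp add: mat_assoc)
    then show "D * U = 0\<^sub>m ?n ?n" unfolding TU using C T by auto
  qed
  have D_sym: "transpose_mat D = D"
    unfolding D_def using T T' C
    by (simp add: transpose_mult[of T ?n k _ ?n] transpose_mult[OF C T'] C_sym mat_assoc)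
  define B where "B = sqrt l \<cdot>\<^sub>m U + D"
  have B: "B \<in> carrier_mat ?n ?n" using U D by (simp add: B_def)
  \<comment> \<open>\<open>U\<close> and \<open>D\<close> act on orthogonal complements, so the
    mixed products vanish and the two parts are squared separately.\<close>
  have "B * B = l \<cdot>\<^sub>m U + D * D"
  proof -
    have "B * B = (sqrt l \<cdot>\<^sub>m U) * (sqrt l \<cdot>\<^sub>m U) + (sqrt l \<cdot>\<^sub>m U) * D + (D * (sqrt l \<cdot>\<^sub>m U) + D * D)"
      using U D add_mult_distrib_mat[of "sqrt l \<cdot>\<^sub>m U" ?n ?n D B ?n] B
        mult_add_distrib_mat[of "sqrt l \<cdot>\<^sub>m U" ?n ?n "sqrt l \<cdot>\<^sub>m U" ?n D]
        mult_add_distrib_mat[of D ?n ?n "sqrt l \<cdot>\<^sub>m U" ?n D]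
      unfolding B_def by simp
    also have "(sqrt l \<cdot>\<^sub>m U) * (sqrt l \<cdot>\<^sub>m U) = l \<cdot>\<^sub>m U"
      using U l mult_smult_assoc_mat[OF U, of "sqrt l \<cdot>\<^sub>m U" ?n "sqrt l"] mult_smult_distrib[OF U U, of "sqrt l"]
      by (simp add: UU smult_smult_mat)
    also have "(sqrt l \<cdot>\<^sub>m U) * D = 0\<^sub>m ?n ?n" using mult_smult_assoc_mat[OF U D] UD by simp
    also have "D * (sqrt l \<cdot>\<^sub>m U) = 0\<^sub>m ?n ?n" using mult_smult_distrib[OF D U] DU by simp
    finally show ?thesis using U D by simp
  qed
  then have "B * B = A" unfolding DD using A U by auto
  moreover have "spd B"
    unfolding spd_def
  proof (intro conjI ballI impI)
    show "square_mat B" using B by simp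
    show "transpose_mat B = B"
      using U D by (simp add: B_def transpose_add[of _ ?n ?n] transpose_smult_mat U_sym D_sym)
    fix v :: "real vec" assume "v \<in> carrier_vec (dim_row B)" "v \<noteq> 0\<^sub>v (dim_row B)"
    then have v: "v \<in> carrier_vec ?n" "v \<noteq> 0\<^sub>v ?n" using B by auto
    have Uv: "U *\<^sub>v v = (u \<bullet> v) \<cdot>\<^sub>v u"
    proof (rule eq_vecI)
      fix i assume "i < dim_vec ((u \<bullet> v) \<cdot>\<^sub>v u)"
      then have i: "i < ?n" using u(1) by simp
      then have "(U *\<^sub>v v) $ i = (\<Sum>j<?n. u $ i * u $ j * v $ j)"
        using v(1) by (simp add: U_def scalar_prod_def atLeast0LessThan del: sum.lessThan_Suc)
      also have "\<dots> = u $ i * (\<Sum>j<?n. u $ j * v $ j)"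
        unfolding sum_distrib_left by (simp only: mult.assoc)
      finally show "(U *\<^sub>v v) $ i = ((u \<bullet> v) \<cdot>\<^sub>v u) $ i"
        using i u(1) v(1) by (simp add: scalar_prod_def atLeast0LessThan del: sum.lessThan_Suc)
    qed (use U u(1) in auto)
    have lU: "sqrt l \<cdot>\<^sub>m U \<in> carrier_mat ?n ?n" using U by simp
    have 1: "v \<bullet> (B *\<^sub>v v) = sqrt l * (u \<bullet> v)\<^sup>2 + (?T *\<^sub>v v) \<bullet> (C *\<^sub>v (?T *\<^sub>v v))"
    proof -
      have "D *\<^sub>v v = T *\<^sub>v (C *\<^sub>v (?T *\<^sub>v v))"
        unfolding D_def using T T' C v
        by (simp add: mat_vec_assoc)
      then have "v \<bullet> (D *\<^sub>v v) = (?T *\<^sub>v v) \<bullet> (C *\<^sub>v (?T *\<^sub>v v))"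
        using T T' C v transpose_vec_mult_scalar[OF T, of "C *\<^sub>v (?T *\<^sub>v v)" v] by simp
      moreover have "v \<bullet> ((sqrt l \<cdot>\<^sub>m U) *\<^sub>v v) = sqrt l * (u \<bullet> v)\<^sup>2"
        using U u v comm_scalar_prod[OF u(1) v(1)] by (simp add: smult_mat_mult_vec Uv power2_eq_square)
      ultimately show ?thesis
        using mult_mat_vec_carrier[OF lU v(1)] mult_mat_vec_carrier[OF D v(1)]
        by (simp add: B_def add_mult_distrib_mat_vec[OF lU D v(1)] scalar_prod_add_distrib[OF v(1)])
    qed
    \<comment> \<open>Neither summand in \<open>1\<close> is negative. The second is positive unless
      \<open>?T\<close> annihilates \<open>v\<close>; in that case \<open>v\<close> is a multiple of
      \<open>u\<close>, and the first is positive.\<close>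
    show "0 < v \<bullet> (B *\<^sub>v v)"
    proof (cases "?T *\<^sub>v v = 0\<^sub>v k")
      case False
      then have "0 < (?T *\<^sub>v v) \<bullet> (C *\<^sub>v (?T *\<^sub>v v))"
        using spdD(2)[OF C_spd C] T' v by simp
      then show ?thesis using 1 l by (simp add: add_nonneg_pos)
    next
      case True
      have "0\<^sub>v ?n = T * ?T *\<^sub>v v" using True T T' v by (simp add: mat_vec_assoc mult_mat_zero_vec)
      also have "\<dots> = v - (u \<bullet> v) \<cdot>\<^sub>v u"
        unfolding TT' using U v by (simp add: minus_mult_distrib_mat_vec[of _ ?n ?n] Uv)
      finally have "u \<bullet> v \<noteq> 0" using v u(1) by auto
      then show ?thesis using 1 l True C by simp
    qed
  qed
  ultimately show ?case using B by blast
qed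

section \<open>Energy norms and induced norms\<close>

text \<open>Existence of a root gives \<open>SOME\<close> its meaning; from here on these three
  properties stand for the definition.\<close>

lemma spd_sqrt:
  assumes "A \<in> carrier_mat n n" "spd A"
  shows "spd_sqrt A \<in> carrier_mat n n" "spd (spd_sqrt A)" "spd_sqrt A * spd_sqrt A = A"
proof -
  have "\<exists>B. B \<in> carrier_mat (dim_row A) (dim_row A) \<and> spd B \<and> B * B = A"
    using spd_square_root_exists[OF assms] assms(1) by simp
  from someI_ex[OF this] assms(1)
  show "spd_sqrt A \<in> carrier_mat n n" "spd (spd_sqrt A)" "spd_sqrt A * spd_sqrt A = A"
    by (auto simp: spd_sqrt_def)
qed

text \<open>A singular matrix would have a nonzero kernel vector, at which the quadratic form
  vanishes. The inverse is needed for the exact solver and for undoing a square root.\<close>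

lemma spd_mat_inverse:
  assumes A: "A \<in> carrier_mat n n" and spd: "spd A"
  obtains B where "mat_inverse A = Some B" "B \<in> carrier_mat n n" "A * B = 1\<^sub>m n" "B * A = 1\<^sub>m n"
proof (cases "mat_inverse A")
  case None
  have "det A \<noteq> 0"
  proof
    assume "det A = 0"
    then obtain v where v: "v \<in> carrier_vec n" "v \<noteq> 0\<^sub>v n" "A *\<^sub>v v = 0\<^sub>v n"
      using det_0_iff_vec_prod_zero[OF A] by auto
    then show False using spdD(2)[OF spd A v(1,2)] by simp
  qed
  then show thesis
    using det_non_zero_imp_unit[OF A, of "()"] mat_inverse(1)[OF A None, of "()"] by simp
next
  case (Some B)
  then show thesis using mat_inverse(2)[OF A Some] that by auto
qed

lemma euclidean_norm_L2_set:
  assumes "v \<in> carrier_vec n"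
  shows "euclidean_norm v = L2_set (($) v) {..<n}"
  using assms by (simp add: euclidean_norm_def L2_set_def scalar_prod_def atLeast0LessThan power2_eq_square)

text \<open>Any finite constant will do, since the only aim is that the supremum in
  \<open>induced_norm\<close> is taken over a bounded set. Each component of \<open>v\<close> is at
  most its norm, so summing absolute entries suffices.\<close>

lemma euclidean_norm_mult_mat_vec_le:
  assumes M: "M \<in> carrier_mat n m" and v: "v \<in> carrier_vec m"
  shows "euclidean_norm (M *\<^sub>v v) \<le> (\<Sum>i<n. \<Sum>j<m. \<bar>M $$ (i, j)\<bar>) * euclidean_norm v"
proof -
  have "euclidean_norm (M *\<^sub>v v) \<le> (\<Sum>i<n. \<bar>(M *\<^sub>v v) $ i\<bar>)"
    unfolding euclidean_norm_L2_set[OF mult_mat_vec_carrier[OF M v]] by (rule L2_set_le_sum_abs)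
  also have "\<dots> \<le> (\<Sum>i<n. (\<Sum>j<m. \<bar>M $$ (i, j)\<bar>) * euclidean_norm v)"
  proof (rule sum_mono)
    fix i assume "i \<in> {..<n}"
    then have "\<bar>(M *\<^sub>v v) $ i\<bar> = \<bar>\<Sum>j<m. M $$ (i, j) * v $ j\<bar>"
      using M v by (simp add: scalar_prod_def atLeast0LessThan)
    also have "\<dots> \<le> (\<Sum>j<m. \<bar>M $$ (i, j)\<bar> * \<bar>v $ j\<bar>)"
      using sum_abs[of "\<lambda>j. M $$ (i, j) * v $ j"] by (simp add: abs_mult)
    also have "\<dots> \<le> (\<Sum>j<m. \<bar>M $$ (i, j)\<bar> * euclidean_norm v)"
    proof (intro sum_mono mult_left_mono)
      fix j assume "j \<in> {..<m}"
      then have "\<bar>v $ j\<bar> \<le> L2_set (\<lambda>j. \<bar>v $ j\<bar>) {..<m}" by (intro member_le_L2_set) auto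
      then show "\<bar>v $ j\<bar> \<le> euclidean_norm v"
        unfolding euclidean_norm_L2_set[OF v] by (simp add: L2_set_def)
    qed simp
    finally show "\<bar>(M *\<^sub>v v) $ i\<bar> \<le> (\<Sum>j<m. \<bar>M $$ (i, j)\<bar>) * euclidean_norm v"
      by (simp add: sum_distrib_right)
  qed
  finally show ?thesis by (simp add: sum_distrib_right)
qed

text \<open>Moving one symmetric root across the scalar product leaves the square of the root, which
  is \<open>A\<close>. In this form positivity and the Galerkin condition apply directly.\<close>

lemma energy_norm_quadratic_form:
  assumes A: "A \<in> carrier_mat n n" and spd: "spd A" and v: "v \<in> carrier_vec n"
  shows "energy_norm A v = sqrt (v \<bullet> (A *\<^sub>v v))"
proof -
  note R = spd_sqrt[OF A spd]
  have Rv: "spd_sqrt A *\<^sub>v v \<in> carrier_vec n" using R(1) v by simp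
  have "(spd_sqrt A *\<^sub>v v) \<bullet> (spd_sqrt A *\<^sub>v v) = v \<bullet> (spd_sqrt A *\<^sub>v (spd_sqrt A *\<^sub>v v))"
    by (rule symmetric_scalar_prod[OF R(1) spdD(1)[OF R(2,1)] Rv v])
  also have "spd_sqrt A *\<^sub>v (spd_sqrt A *\<^sub>v v) = A *\<^sub>v v"
    using R(1,3) v by (subst mat_vec_assoc[symmetric]) auto
  finally show ?thesis by (simp add: energy_norm_def euclidean_norm_def)
qed

lemma energy_norm_zero:
  assumes "A \<in> carrier_mat n n" "spd A"
  shows "energy_norm A (0\<^sub>v n) = 0"
  using assms by (simp add: energy_norm_quadratic_form[OF assms] mult_mat_zero_vec[OF assms(1)])

lemma energy_norm_pos:
  assumes "A \<in> carrier_mat n n" "spd A" "v \<in> carrier_vec n" "v \<noteq> 0\<^sub>v n"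
  shows "energy_norm A v > 0"
  using assms spdD(2)[OF assms(2,1,3,4)] by (simp add: energy_norm_quadratic_form)

lemma energy_norm_nonneg:
  assumes "A \<in> carrier_mat n n" "spd A" "v \<in> carrier_vec n"
  shows "energy_norm A v \<ge> 0"
  using energy_norm_pos[OF assms] energy_norm_zero[OF assms(1,2)]
  by (cases "v = 0\<^sub>v n") auto

lemma euclidean_norm_triangle:
  assumes v: "v \<in> carrier_vec n" and w: "w \<in> carrier_vec n"
  shows "euclidean_norm (v + w) \<le> euclidean_norm v + euclidean_norm w"
proof -
  have "euclidean_norm (v + w) = L2_set (\<lambda>i. v $ i + w $ i) {..<n}"
    unfolding euclidean_norm_L2_set[OF add_carrier_vec[OF v w]] using w by (intro L2_set_cong) auto
  then show ?thesis
    unfolding euclidean_norm_L2_set[OF v] euclidean_norm_L2_set[OF w]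
    by (simp add: L2_set_triangle_ineq)
qed

lemma energy_norm_triangle:
  assumes A: "A \<in> carrier_mat n n" and spd: "spd A"
    and v: "v \<in> carrier_vec n" and w: "w \<in> carrier_vec n"
  shows "energy_norm A (v + w) \<le> energy_norm A v + energy_norm A w"
proof -
  note R = spd_sqrt(1)[OF A spd]
  show ?thesis
    unfolding energy_norm_def mult_add_distrib_mat_vec[OF R v w]
    using R v w by (intro euclidean_norm_triangle[of _ n]) auto
qed

text \<open>Inserting the inverse \<open>Q\<close> of the root of \<open>A\<close> turns the claim
  into a Euclidean bound for the matrix \<open>?M\<close>, applied to the root of \<open>A\<close>
  times \<open>v\<close>.\<close>

lemma energy_norm_mult_mat_vec_bounded:
  assumes A: "A \<in> carrier_mat n n" "spd A" and B: "B \<in> carrier_mat m m" "spd B"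
    and S: "S \<in> carrier_mat m n"
  obtains K where "\<And>v. v \<in> carrier_vec n \<Longrightarrow> energy_norm B (S *\<^sub>v v) \<le> K * energy_norm A v"
proof -
  note R = spd_sqrt[OF A] and RB = spd_sqrt(1)[OF B]
  obtain Q where Q: "Q \<in> carrier_mat n n" "Q * spd_sqrt A = 1\<^sub>m n"
    using spd_mat_inverse[OF R(1,2)] by blast
  let ?M = "spd_sqrt B * S * Q"
  have M: "?M \<in> carrier_mat m n" using RB S Q by simp
  have "energy_norm B (S *\<^sub>v v) \<le> (\<Sum>i<m. \<Sum>j<n. \<bar>?M $$ (i, j)\<bar>) * energy_norm A v"
    if v: "v \<in> carrier_vec n" for v
  proof -
    have Rv: "spd_sqrt A *\<^sub>v v \<in> carrier_vec n" using R(1) v by simp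
    have "v = Q *\<^sub>v (spd_sqrt A *\<^sub>v v)"
      using Q R(1) v by (subst mat_vec_assoc[symmetric]) auto
    then have "spd_sqrt B *\<^sub>v (S *\<^sub>v v) = ?M *\<^sub>v (spd_sqrt A *\<^sub>v v)"
      using Q(1) R(1) RB S v by (simp add: mat_vec_assoc)
    then show ?thesis
      unfolding energy_norm_def using euclidean_norm_mult_mat_vec_le[OF M Rv] by simp
  qed
  then show thesis by (rule that)
qed

lemma energy_norm_le_induced_norm:
  assumes A: "A \<in> carrier_mat n n" "spd A" and B: "B \<in> carrier_mat m m" "spd B"
    and S: "S \<in> carrier_mat m n" and v: "v \<in> carrier_vec n"
  shows "energy_norm B (S *\<^sub>v v) \<le> induced_norm A B S * energy_norm A v"
proof (cases "v = 0\<^sub>v n")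
  case True
  then show ?thesis
    using energy_norm_zero[OF A] energy_norm_zero[OF B] mult_mat_zero_vec[OF S] by simp
next
  case False
  let ?q = "\<lambda>v. energy_norm B (S *\<^sub>v v) / energy_norm A v"
  obtain K where K: "\<And>v. v \<in> carrier_vec n \<Longrightarrow> energy_norm B (S *\<^sub>v v) \<le> K * energy_norm A v"
    using energy_norm_mult_mat_vec_bounded[OF A B S] by blast
  have "bdd_above (?q ` (carrier_vec n - {0\<^sub>v n}))"
    using K energy_norm_pos[OF A] by (intro bdd_aboveI2[of _ _ K]) (auto simp: pos_divide_le_eq)
  then have "?q v \<le> induced_norm A B S"
    unfolding induced_norm_def using S v False by (intro cSUP_upper) auto
  then show ?thesis using energy_norm_pos[OF A v False] by (simp add: pos_divide_le_eq)
qed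

text \<open>Positive dimension supplies a unit vector, so the supremum is over a nonempty set and
  inherits every upper bound.\<close>

lemma induced_norm_le:
  assumes A: "A \<in> carrier_mat n n" "spd A" and n: "n \<ge> 1" and S: "S \<in> carrier_mat m n"
    and le: "\<And>v. v \<in> carrier_vec n \<Longrightarrow> energy_norm B (S *\<^sub>v v) \<le> c * energy_norm A v"
  shows "induced_norm A B S \<le> c"
  unfolding induced_norm_def
proof (rule cSUP_least)
  have "unit_vec n 0 \<in> carrier_vec (dim_col S) - {0\<^sub>v (dim_col S) :: real vec}" using n S by auto
  then show "carrier_vec (dim_col S) - {0\<^sub>v (dim_col S) :: real vec} \<noteq> {}" by blast
  fix v :: "real vec" assume "v \<in> carrier_vec (dim_col S) - {0\<^sub>v (dim_col S)}"
  then show "energy_norm B (S *\<^sub>v v) / energy_norm A v \<le> c"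
    using le S energy_norm_pos[OF A] by (auto simp: pos_divide_le_eq)
qed

lemma induced_norm_nonneg:
  assumes A: "A \<in> carrier_mat n n" "spd A" and B: "B \<in> carrier_mat m m" "spd B"
    and n: "n \<ge> 1" and S: "S \<in> carrier_mat m n"
  shows "induced_norm A B S \<ge> 0"
proof -
  let ?e = "unit_vec n 0 :: real vec"
  have e: "?e \<in> carrier_vec n" "?e \<noteq> 0\<^sub>v n" using n by auto
  have "0 \<le> energy_norm B (S *\<^sub>v ?e)" using S e by (intro energy_norm_nonneg[OF B]) auto
  also have "\<dots> \<le> induced_norm A B S * energy_norm A ?e"
    by (rule energy_norm_le_induced_norm[OF A B S e(1)])
  finally show ?thesis using energy_norm_pos[OF A e] by (simp add: zero_le_mult_iff)
qed

section \<open>The multigrid hierarchy\<close>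

lemma full_rank_imp_inj:
  fixes P :: "'a :: field mat"
  assumes P: "P \<in> carrier_mat n m" and rank: "vec_space.rank n P = m"
    and v: "v \<in> carrier_vec m" "P *\<^sub>v v = 0\<^sub>v n"
  shows "v = 0\<^sub>v m"
proof (rule ccontr)
  assume "v \<noteq> 0\<^sub>v m"
  interpret vec_space "TYPE('a)" n .
  \<comment> \<open>Independence is a statement about the set of columns, in which repetitions
    disappear. A maximal independent subset has \<open>m\<close> elements by the rank hypothesis, so
    the \<open>m\<close> columns must be pairwise different.\<close>
  have "distinct (cols P)"
  proof (rule card_distinct)
    obtain S where S: "maximal S (\<lambda>T. T \<subseteq> set (cols P) \<and> lin_indpt T)"
      using maximal_exists[of "\<lambda>T. T \<subseteq> set (cols P) \<and> lin_indpt T" "card (set (cols P))" "{}"]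
      by (meson List.finite_set card_mono empty_iff empty_subsetI finite_lin_indpt2 rev_finite_subset)
    then have "card S \<le> card (set (cols P))" by (simp add: card_mono maximal_def)
    then show "card (set (cols P)) = length (cols P)"
      using rank_card_indpt[OF P S] rank P card_length[of "cols P"] by simp
  qed
  then show False
    using full_rank_lin_indpt[OF P rank] lin_depI[OF P v(1) \<open>v \<noteq> 0\<^sub>v m\<close> v(2)] by blast
qed

lemma exact_solve:
  assumes A: "A \<in> carrier_mat n n" and spd: "spd A"
  shows "f \<in> carrier_vec n \<Longrightarrow> exact_solve A f \<in> carrier_vec n"
    and "f \<in> carrier_vec n \<Longrightarrow> A *\<^sub>v exact_solve A f = f"
    and "v \<in> carrier_vec n \<Longrightarrow> exact_solve A (A *\<^sub>v v) = v"
proof -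
  obtain B where B: "mat_inverse A = Some B" "B \<in> carrier_mat n n" "A * B = 1\<^sub>m n" "B * A = 1\<^sub>m n"
    using spd_mat_inverse[OF A spd] by blast
  show "exact_solve A f \<in> carrier_vec n" if "f \<in> carrier_vec n"
    using B that by (simp add: exact_solve_def)
  show "A *\<^sub>v exact_solve A f = f" if f: "f \<in> carrier_vec n"
  proof -
    have "A *\<^sub>v exact_solve A f = A * B *\<^sub>v f" using mat_vec_assoc[of A B f] A B(1,2) f by (simp add: exact_solve_def)
    then show ?thesis unfolding B(3) using f by simp
  qed
  show "exact_solve A (A *\<^sub>v v) = v" if v: "v \<in> carrier_vec n"
  proof -
    have "exact_solve A (A *\<^sub>v v) = B * A *\<^sub>v v" using mat_vec_assoc[of B A v] A B(1,2) v by (simp add: exact_solve_def)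
    then show ?thesis unfolding B(4) using v by simp
  qed
qed

section \<open>Smoothing steps and Galerkin levels\<close>

lemma smooth_carrier:
  assumes "A \<in> carrier_mat n n" "M \<in> carrier_mat n n" "f \<in> carrier_vec n" "v \<in> carrier_vec n"
  shows "smooth A M f v \<in> carrier_vec n"
  unfolding smooth_def using assms by (intro add_carrier_vec mult_mat_vec_carrier[of _ n n] minus_carrier_vec) auto

lemma restricted_residual_carrier:
  assumes "A \<in> carrier_mat n n" "P \<in> carrier_mat n m" "f \<in> carrier_vec n" "v \<in> carrier_vec n"
  shows "restricted_residual A P f v \<in> carrier_vec m"
  unfolding restricted_residual_def using assms
  by (intro mult_mat_vec_carrier[of _ m n] minus_carrier_vec) auto

text \<open>With a common right-hand side, \<open>f\<close> cancels. Taking the exact solution for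
  one argument yields the error propagation of the smoother, because that solution is a fixed
  point.\<close>

lemma smooth_diff:
  assumes A: "A \<in> carrier_mat n n" and M: "M \<in> carrier_mat n n"
    and f: "f \<in> carrier_vec n" and v: "v \<in> carrier_vec n" and w: "w \<in> carrier_vec n"
  shows "smooth A M f v - smooth A M f w = (1\<^sub>m n - M * A) *\<^sub>v (v - w)"
proof -
  have Av: "A *\<^sub>v v \<in> carrier_vec n" and Aw: "A *\<^sub>v w \<in> carrier_vec n" using A v w by auto
  have MA: "M * A \<in> carrier_mat n n" using M A by simp
  have vw: "v - w \<in> carrier_vec n" using v w by simp
  have "(1\<^sub>m n - M * A) *\<^sub>v (v - w) = (v - w) - (M *\<^sub>v (A *\<^sub>v v) - M *\<^sub>v (A *\<^sub>v w))"
    unfolding minus_mult_distrib_mat_vec[OF one_carrier_mat MA vw] mult_minus_distrib_mat_vec[OF MA v w]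
      one_mult_mat_vec[OF vw] using M A v w by (simp add: mat_vec_assoc)
  then show ?thesis
    unfolding smooth_def mult_minus_distrib_mat_vec[OF M f Av] mult_minus_distrib_mat_vec[OF M f Aw]
    using M f Av Aw v w by (intro eq_vecI) (auto simp del: index_mult_mat_vec)
qed

lemma smooth_fixed_point:
  assumes A: "A \<in> carrier_mat n n" and M: "M \<in> carrier_mat n n" and u: "u \<in> carrier_vec n"
  shows "smooth A M (A *\<^sub>v u) u = u"
proof -
  have "A *\<^sub>v u - A *\<^sub>v u = 0\<^sub>v n" using A u by simp
  then show ?thesis using u by (simp add: smooth_def mult_mat_zero_vec[OF M])
qed

text \<open>Levels are paired as \<open>j\<close> and \<open>Suc j\<close>, to fit the recursion of
  \<open>vcycle\<close> and avoid subtraction on indices.\<close>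

locale galerkin_hierarchy =
  fixes J :: nat and n :: "nat \<Rightarrow> nat" and A P :: "nat \<Rightarrow> real mat"
  assumes A_carrier: "\<And>j. j \<le> J \<Longrightarrow> A j \<in> carrier_mat (n j) (n j)"
    and A_spd: "spd (A J)"
    and P_carrier: "\<And>j. j < J \<Longrightarrow> P (Suc j) \<in> carrier_mat (n (Suc j)) (n j)"
    and P_full_rank: "\<And>j. j < J \<Longrightarrow> vec_space.rank (n (Suc j)) (P (Suc j)) = n j"
    and galerkin: "\<And>j. j < J \<Longrightarrow> A j = transpose_mat (P (Suc j)) * A (Suc j) * P (Suc j)"
begin

text \<open>The induction runs downwards from the finest level: each coarser matrix is a congruence
  of the next finer one, by a prolongation that full rank makes injective.\<close>

lemma spd_level:
  assumes "j \<le> J"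
  shows "spd (A j)"
  using assms
proof (induction rule: inc_induct)
  case base
  show ?case by (rule A_spd)
next
  case (step j)
  then show ?case
    using full_rank_imp_inj[OF P_carrier P_full_rank] A_carrier P_carrier galerkin
    by (auto intro: spd_congruence[of _ "n (Suc j)" _ "n j"])
qed

lemma energy_norm_prolong:
  assumes j: "j < J" and v: "v \<in> carrier_vec (n j)"
  shows "energy_norm (A (Suc j)) (P (Suc j) *\<^sub>v v) = energy_norm (A j) v"
proof -
  let ?P = "P (Suc j)" and ?A = "A (Suc j)"
  have P: "?P \<in> carrier_mat (n (Suc j)) (n j)" and A': "?A \<in> carrier_mat (n (Suc j)) (n (Suc j))"
    and A: "A j \<in> carrier_mat (n j) (n j)"
    using j P_carrier A_carrier by auto
  have Pv: "?P *\<^sub>v v \<in> carrier_vec (n (Suc j))" using P v by simp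
  have Av: "A j *\<^sub>v v = transpose_mat ?P *\<^sub>v (?A *\<^sub>v (?P *\<^sub>v v))"
    unfolding galerkin[OF j] using P A' v by (simp add: mat_vec_assoc)
  have "v \<bullet> (A j *\<^sub>v v) = (A j *\<^sub>v v) \<bullet> v" using A v by (intro comm_scalar_prod) auto
  also have "\<dots> = (?A *\<^sub>v (?P *\<^sub>v v)) \<bullet> (?P *\<^sub>v v)"
    unfolding Av by (rule transpose_vec_mult_scalar[OF P v mult_mat_vec_carrier[OF A' Pv]])
  also have "\<dots> = (?P *\<^sub>v v) \<bullet> (?A *\<^sub>v (?P *\<^sub>v v))"
    by (rule comm_scalar_prod[OF mult_mat_vec_carrier[OF A' Pv] Pv])
  finally show ?thesis
    using energy_norm_quadratic_form[OF A spd_level v] energy_norm_quadratic_form[OF A' spd_level Pv] j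
    by simp
qed

end

section \<open>Algebra of the V-cycle: solver differences and error matrices\<close>

locale multigrid = galerkin_hierarchy +
  fixes M N :: "nat \<Rightarrow> real mat"
  assumes M_carrier: "\<And>j. j < J \<Longrightarrow> M (Suc j) \<in> carrier_mat (n (Suc j)) (n (Suc j))"
    and N_carrier: "\<And>j. j < J \<Longrightarrow> N (Suc j) \<in> carrier_mat (n (Suc j)) (n (Suc j))"
begin

lemma level_carriers:
  assumes "j < J"
  shows "A j \<in> carrier_mat (n j) (n j)" "A (Suc j) \<in> carrier_mat (n (Suc j)) (n (Suc j))"
    "P (Suc j) \<in> carrier_mat (n (Suc j)) (n j)" "M (Suc j) \<in> carrier_mat (n (Suc j)) (n (Suc j))"
    "N (Suc j) \<in> carrier_mat (n (Suc j)) (n (Suc j))" "spd (A j)"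
  using assms A_carrier P_carrier M_carrier N_carrier spd_level by auto

lemma coarsest_rhs_carrier:
  assumes "j \<le> J" "f \<in> carrier_vec (n j)" "v \<in> carrier_vec (n j)"
  shows "coarsest_rhs A P M j f v \<in> carrier_vec (n 0)"
  using assms
proof (induction j arbitrary: f v)
  case (Suc j)
  then have "j < J" by simp
  note c = level_carriers[OF this]
  show ?case
    using Suc smooth_carrier[OF c(2,4)] restricted_residual_carrier[OF c(2,3)] c(1)
    by (simp add: Let_def)
qed simp

lemma vcycle_carrier:
  assumes "j \<le> J" "f \<in> carrier_vec (n j)" "v \<in> carrier_vec (n j)"
    and C: "\<And>f. f \<in> carrier_vec (n 0) \<Longrightarrow> C f \<in> carrier_vec (n 0)"
  shows "vcycle A P M N C j f v \<in> carrier_vec (n j)"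
  using assms(1-3)
proof (induction j arbitrary: f v)
  case (Suc j)
  then have "j < J" by simp
  note c = level_carriers[OF this]
  let ?v1 = "smooth (A (Suc j)) (M (Suc j)) f v"
  let ?v2 = "vcycle A P M N C j (restricted_residual (A (Suc j)) (P (Suc j)) f ?v1) (0\<^sub>v (dim_row (A j)))"
  have v1: "?v1 \<in> carrier_vec (n (Suc j))" using smooth_carrier[OF c(2,4)] Suc.prems by simp
  have "?v2 \<in> carrier_vec (n j)"
    using Suc restricted_residual_carrier[OF c(2,3) _ v1] c(1) by simp
  then show ?case
    using smooth_carrier[OF c(2,5)] v1 c(3) Suc.prems by (simp add: Let_def)
qed (simp add: C)

lemma coarse_to_fine_carrier: "j \<le> J \<Longrightarrow> coarse_to_fine A P N j \<in> carrier_mat (n j) (n 0)"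
proof (induction j)
  case 0
  then show ?case using A_carrier[of 0] by simp
next
  case (Suc j)
  then have "j < J" by simp
  note c = level_carriers[OF this]
  have NA: "1\<^sub>m (n (Suc j)) - N (Suc j) * A (Suc j) \<in> carrier_mat (n (Suc j)) (n (Suc j))"
    using c by (intro minus_carrier_mat mult_carrier_mat) auto
  show ?case
    using mult_carrier_mat[OF mult_carrier_mat[OF NA c(3)] Suc.IH] c(2) Suc.prems by simp
qed

text \<open>The solvers are arbitrary maps; only their values at one common argument enter. On the
  way up each level prolongs the difference and post-smooths it, which multiplies by the next factor
  of \<open>coarse_to_fine\<close> from the left.\<close>

lemma vcycle_diff:
  assumes "j \<le> J" "f \<in> carrier_vec (n j)" "v \<in> carrier_vec (n j)"
    and C: "\<And>f. f \<in> carrier_vec (n 0) \<Longrightarrow> C f \<in> carrier_vec (n 0)"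
    and C': "\<And>f. f \<in> carrier_vec (n 0) \<Longrightarrow> C' f \<in> carrier_vec (n 0)"
  shows "vcycle A P M N C j f v - vcycle A P M N C' j f v
    = coarse_to_fine A P N j *\<^sub>v (C (coarsest_rhs A P M j f v) - C' (coarsest_rhs A P M j f v))"
  using assms(1-3)
proof (induction j arbitrary: f v)
  case 0
  then show ?case using C C' A_carrier[of 0] by simp
next
  case (Suc j)
  then have j: "j < J" by simp
  note c = level_carriers[OF j] and f = Suc.prems(2)
  let ?A = "A (Suc j)" and ?P = "P (Suc j)" and ?N = "N (Suc j)"
  define v1 where "v1 = smooth ?A (M (Suc j)) f v"
  define f' where "f' = restricted_residual ?A ?P f v1"
  define r where "r = coarsest_rhs A P M j f' (0\<^sub>v (n j))"
  define v2 where "v2 C = vcycle A P M N C j f' (0\<^sub>v (n j))" for C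
  have v1: "v1 \<in> carrier_vec (n (Suc j))"
    unfolding v1_def using smooth_carrier[OF c(2,4)] Suc.prems by simp
  have f': "f' \<in> carrier_vec (n j)"
    unfolding f'_def by (rule restricted_residual_carrier[OF c(2,3) f v1])
  have r: "r \<in> carrier_vec (n 0)"
    unfolding r_def using coarsest_rhs_carrier[OF _ f'] j by simp
  have v2: "v2 C \<in> carrier_vec (n j)" "v2 C' \<in> carrier_vec (n j)"
    unfolding v2_def using vcycle_carrier[OF _ f' _ C] vcycle_carrier[OF _ f' _ C'] j by auto
  then have Pv2: "?P *\<^sub>v v2 C \<in> carrier_vec (n (Suc j))" "?P *\<^sub>v v2 C' \<in> carrier_vec (n (Suc j))"
    using c(3) by auto
  have S: "coarse_to_fine A P N j \<in> carrier_mat (n j) (n 0)" using coarse_to_fine_carrier j by simp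
  define d where "d = C r - C' r"
  have d: "d \<in> carrier_vec (n 0)" unfolding d_def using C C' r by simp
  have NA: "1\<^sub>m (n (Suc j)) - ?N * ?A \<in> carrier_mat (n (Suc j)) (n (Suc j))"
    using c by (intro minus_carrier_mat mult_carrier_mat) auto
  have IH: "v2 C - v2 C' = coarse_to_fine A P N j *\<^sub>v d"
    unfolding v2_def d_def r_def using Suc.IH[OF _ f'] j by simp
  have "vcycle A P M N C (Suc j) f v - vcycle A P M N C' (Suc j) f v
    = smooth ?A ?N f (v1 + ?P *\<^sub>v v2 C) - smooth ?A ?N f (v1 + ?P *\<^sub>v v2 C')"
    using c(1) by (simp add: v1_def f'_def v2_def Let_def)
  also have "\<dots> = (1\<^sub>m (n (Suc j)) - ?N * ?A) *\<^sub>v ((v1 + ?P *\<^sub>v v2 C) - (v1 + ?P *\<^sub>v v2 C'))"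
    using v1 Pv2 by (intro smooth_diff[OF c(2,5) f]) auto
  also have "(v1 + ?P *\<^sub>v v2 C) - (v1 + ?P *\<^sub>v v2 C') = ?P *\<^sub>v (v2 C - v2 C')"
    unfolding mult_minus_distrib_mat_vec[OF c(3) v2]
    using v1 Pv2 by (intro eq_vecI) (auto simp del: index_mult_mat_vec)
  also have "(1\<^sub>m (n (Suc j)) - ?N * ?A) *\<^sub>v \<dots> = coarse_to_fine A P N (Suc j) *\<^sub>v d"
    unfolding IH using NA c S d by (simp add: mat_vec_assoc)
  finally show ?case using c(1) by (simp add: d_def v1_def f'_def r_def Let_def)
qed

text \<open>Writing the right-hand side as \<open>A j\<close> times \<open>u\<close> makes
  \<open>u\<close> the exact solution on that level. The matrix is built by recursion:
  pre-smoothing, coarse-grid correction and post-smoothing each multiply the error by a matrix, and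
  on level 0 the exact solver leaves no error.\<close>

lemma vcycle_exact_error_matrix:
  assumes "j \<le> J"
  shows "\<exists>E. E \<in> carrier_mat (n j) (n j) \<and>
    (\<forall>u\<in>carrier_vec (n j). \<forall>v\<in>carrier_vec (n j).
      u - vcycle A P M N (exact_solve (A 0)) j (A j *\<^sub>v u) v = E *\<^sub>v (u - v))"
  using assms
proof (induction j)
  case 0
  have "u - exact_solve (A 0) (A 0 *\<^sub>v u) = 0\<^sub>m (n 0) (n 0) *\<^sub>v (u - v)"
    if "u \<in> carrier_vec (n 0)" "v \<in> carrier_vec (n 0)" for u v
    using that exact_solve(3)[OF A_carrier spd_level] by (intro eq_vecI) auto
  then show ?case by (intro exI[of _ "0\<^sub>m (n 0) (n 0)"]) simp
next
  case (Suc j)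
  then have j: "j < J" by simp
  note c = level_carriers[OF j]
  let ?A = "A (Suc j)" and ?P = "P (Suc j)" and ?N = "N (Suc j)" and ?M = "M (Suc j)"
  let ?k = "n (Suc j)" and ?C = "exact_solve (A 0)"
  obtain E where E: "E \<in> carrier_mat (n j) (n j)"
    and E_error: "\<And>u v. u \<in> carrier_vec (n j) \<Longrightarrow> v \<in> carrier_vec (n j) \<Longrightarrow>
      u - vcycle A P M N ?C j (A j *\<^sub>v u) v = E *\<^sub>v (u - v)"
    using Suc by auto
  obtain Q where Q: "mat_inverse (A j) = Some Q" "Q \<in> carrier_mat (n j) (n j)"
    using spd_mat_inverse[OF c(1,6)] by blast
  \<comment> \<open>The correction added to \<open>v1\<close>, as a linear function of the error
    \<open>u - v1\<close>: restrict the residual, solve with \<open>Q\<close>, apply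
    \<open>1 - E\<close> since the coarse cycle is inexact on its own level, and prolong.\<close>
  define G where "G = ?P * ((1\<^sub>m (n j) - E) * (Q * (transpose_mat ?P * ?A)))"
  have G: "G \<in> carrier_mat ?k ?k" unfolding G_def using c E Q minus_carrier_mat[OF E] by auto
  define F where "F = (1\<^sub>m ?k - ?N * ?A) * ((1\<^sub>m ?k - G) * (1\<^sub>m ?k - ?M * ?A))"
  have NA: "1\<^sub>m ?k - ?N * ?A \<in> carrier_mat ?k ?k" and MA: "1\<^sub>m ?k - ?M * ?A \<in> carrier_mat ?k ?k"
    and IG: "1\<^sub>m ?k - G \<in> carrier_mat ?k ?k" and IE: "1\<^sub>m (n j) - E \<in> carrier_mat (n j) (n j)"
    using c G E by (auto intro!: minus_carrier_mat)
  have F: "F \<in> carrier_mat ?k ?k" unfolding F_def using NA MA IG by simp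
  have "u - vcycle A P M N ?C (Suc j) (?A *\<^sub>v u) v = F *\<^sub>v (u - v)"
    if u: "u \<in> carrier_vec ?k" and v: "v \<in> carrier_vec ?k" for u v
  proof -
    define v1 where "v1 = smooth ?A ?M (?A *\<^sub>v u) v"
    define f' where "f' = restricted_residual ?A ?P (?A *\<^sub>v u) v1"
    define v2 where "v2 = vcycle A P M N ?C j f' (0\<^sub>v (n j))"
    define w where "w = exact_solve (A j) f'"
    have Au: "?A *\<^sub>v u \<in> carrier_vec ?k" using c u by simp
    have v1: "v1 \<in> carrier_vec ?k" unfolding v1_def by (rule smooth_carrier[OF c(2,4) Au v])
    have e1: "u - v1 = (1\<^sub>m ?k - ?M * ?A) *\<^sub>v (u - v)"
      using smooth_diff[OF c(2,4) Au u v] smooth_fixed_point[OF c(2,4) u] by (simp add: v1_def)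
    have uv1: "u - v1 \<in> carrier_vec ?k" using u v1 by simp
    have f': "f' \<in> carrier_vec (n j)" unfolding f'_def by (rule restricted_residual_carrier[OF c(2,3) Au v1])
    have w: "w \<in> carrier_vec (n j)" "A j *\<^sub>v w = f'"
      unfolding w_def using exact_solve[OF c(1,6)] f' by auto
    have v2: "v2 \<in> carrier_vec (n j)"
      unfolding v2_def using vcycle_carrier[OF _ f'] exact_solve(1)[OF A_carrier spd_level] j by simp
    \<comment> \<open>The coarse cycle starts from zero, so its initial error is the coarse solution
      \<open>w\<close> itself.\<close>
    have "w - v2 = E *\<^sub>v w" using E_error[OF w(1), of "0\<^sub>v (n j)"] w by (simp add: v2_def)
    then have "v2 = w - E *\<^sub>v w"
      using w v2 E by (intro eq_vecI) (auto simp: vec_eq_iff simp del: index_mult_mat_vec)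
    also have "\<dots> = (1\<^sub>m (n j) - E) *\<^sub>v w"
      unfolding minus_mult_distrib_mat_vec[OF one_carrier_mat E w(1)] using w by simp
    also have "w = Q *\<^sub>v (transpose_mat ?P *\<^sub>v (?A *\<^sub>v (u - v1)))"
      unfolding w_def f'_def restricted_residual_def mult_minus_distrib_mat_vec[OF c(2) u v1]
      by (simp add: exact_solve_def Q)
    finally have Pv2: "?P *\<^sub>v v2 = G *\<^sub>v (u - v1)"
      unfolding G_def using c E Q IE u v1 by (simp add: mat_vec_assoc)
    have Gu: "G *\<^sub>v (u - v1) \<in> carrier_vec ?k" using G uv1 by simp
    have v3: "v1 + ?P *\<^sub>v v2 \<in> carrier_vec ?k" unfolding Pv2 using v1 Gu by simp
    have e3: "u - (v1 + ?P *\<^sub>v v2) = (1\<^sub>m ?k - G) *\<^sub>v (u - v1)"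
      unfolding Pv2 minus_mult_distrib_mat_vec[OF one_carrier_mat G uv1] one_mult_mat_vec[OF uv1]
      using G u v1 Gu by (intro eq_vecI) (auto simp del: index_mult_mat_vec)
    have "u - vcycle A P M N ?C (Suc j) (?A *\<^sub>v u) v
      = smooth ?A ?N (?A *\<^sub>v u) u - smooth ?A ?N (?A *\<^sub>v u) (v1 + ?P *\<^sub>v v2)"
      using c(1) smooth_fixed_point[OF c(2,5) u] by (simp add: v1_def v2_def f'_def Let_def)
    also have "\<dots> = (1\<^sub>m ?k - ?N * ?A) *\<^sub>v (u - (v1 + ?P *\<^sub>v v2))"
      by (rule smooth_diff[OF c(2,5) Au u v3])
    also have "\<dots> = F *\<^sub>v (u - v)"
      unfolding e3 e1 F_def using c G u v by (simp add: mat_vec_assoc)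
    finally show ?thesis .
  qed
  then show ?case using F by (intro exI[of _ F]) simp
qed

end

section \<open>The matrices \<open>E\<close> and \<open>S\<close> on the finest level\<close>

lemma mat_eq_of_mult_vec_eq:
  fixes A B :: "'a :: semiring_1 mat"
  assumes A: "A \<in> carrier_mat n m" and B: "B \<in> carrier_mat n m"
    and eq: "\<And>v. v \<in> carrier_vec m \<Longrightarrow> A *\<^sub>v v = B *\<^sub>v v"
  shows "A = B"
proof (rule eq_matI)
  fix i j assume "i < dim_row B" "j < dim_col B"
  then have ij: "i < n" "j < m" using B by auto
  have "(A *\<^sub>v unit_vec m j) $ i = (B *\<^sub>v unit_vec m j) $ i" using eq by simp
  then show "A $$ (i, j) = B $$ (i, j)" using A B ij by simp
qed (use A B in auto)

text \<open>The non-strict bound is what both cases share: a convergent smoother has norm below 1,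
  whereas without smoothing the matrix is the identity.\<close>

lemma smoother_nonexpansive:
  assumes A: "A \<in> carrier_mat n n" "spd A" and N: "N \<in> carrier_mat n n"
    and smoother: "convergent_smoother A N \<or> N = 0\<^sub>m n n" and v: "v \<in> carrier_vec n"
  shows "energy_norm A ((1\<^sub>m n - N * A) *\<^sub>v v) \<le> energy_norm A v"
  using smoother
proof
  assume "convergent_smoother A N"
  then have "induced_norm A A (1\<^sub>m n - N * A) \<le> 1" using A by (simp add: convergent_smoother_def)
  have "1\<^sub>m n - N * A \<in> carrier_mat n n" using A N by (intro minus_carrier_mat) auto
  then have "energy_norm A ((1\<^sub>m n - N * A) *\<^sub>v v)
    \<le> induced_norm A A (1\<^sub>m n - N * A) * energy_norm A v"
    using v by (rule energy_norm_le_induced_norm[OF A A])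
  also have "\<dots> \<le> 1 * energy_norm A v"
    by (intro mult_right_mono energy_norm_nonneg[OF A v]) fact
  finally show ?thesis by simp
next
  assume "N = 0\<^sub>m n n"
  then have "1\<^sub>m n - N * A = 1\<^sub>m n" using A by (intro eq_matI) auto
  then show ?thesis using v by simp
qed

context multigrid
begin

text \<open>Resolves the definite description. For uniqueness, start from zero with right-hand side
  \<open>A J\<close> times \<open>w\<close>: the error equation then fixes the value of the matrix
  at an arbitrary \<open>w\<close>.\<close>

lemma error_propagation_matrix:
  shows "error_propagation_matrix A P M N J \<in> carrier_mat (n J) (n J)"
    and "b \<in> carrier_vec (n J) \<Longrightarrow> v \<in> carrier_vec (n J) \<Longrightarrow>
      exact_solve (A J) b - vcycle A P M N (exact_solve (A 0)) J b v
        = error_propagation_matrix A P M N J *\<^sub>v (exact_solve (A J) b - v)"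
proof -
  let ?V = "vcycle A P M N (exact_solve (A 0)) J"
  let ?is_E = "\<lambda>E. E \<in> carrier_mat (n J) (n J) \<and> (\<forall>b\<in>carrier_vec (n J). \<forall>v\<in>carrier_vec (n J).
    exact_solve (A J) b - ?V b v = E *\<^sub>v (exact_solve (A J) b - v))"
  note AJ = A_carrier[OF order_refl]
  note solve = exact_solve[OF AJ A_spd]
  obtain E where E: "E \<in> carrier_mat (n J) (n J)"
    and E_error: "\<And>u v. u \<in> carrier_vec (n J) \<Longrightarrow> v \<in> carrier_vec (n J) \<Longrightarrow>
      u - ?V (A J *\<^sub>v u) v = E *\<^sub>v (u - v)"
    using vcycle_exact_error_matrix[of J] by auto
  have is_E: "?is_E E" using E E_error[OF solve(1)] solve(2) by simp
  have unique: "F = E" if F: "?is_E F" for F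
  proof (rule mat_eq_of_mult_vec_eq[OF _ E])
    show "F \<in> carrier_mat (n J) (n J)" using F by simp
    fix w :: "real vec" assume w: "w \<in> carrier_vec (n J)"
    have "F *\<^sub>v (w - 0\<^sub>v (n J)) = w - ?V (A J *\<^sub>v w) (0\<^sub>v (n J))"
      using F w solve(3)[OF w] mult_mat_vec_carrier[OF AJ w] by (metis zero_carrier_vec)
    also have "\<dots> = E *\<^sub>v (w - 0\<^sub>v (n J))" by (rule E_error[OF w zero_carrier_vec])
    finally show "F *\<^sub>v w = E *\<^sub>v w" using w by simp
  qed
  have "error_propagation_matrix A P M N J = (THE E. ?is_E E)"
    using AJ by (simp add: error_propagation_matrix_def)
  also have "\<dots> = E" using is_E unique by (rule the_equality)
  finally show "error_propagation_matrix A P M N J \<in> carrier_mat (n J) (n J)"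
    and "b \<in> carrier_vec (n J) \<Longrightarrow> v \<in> carrier_vec (n J) \<Longrightarrow>
      exact_solve (A J) b - ?V b v = error_propagation_matrix A P M N J *\<^sub>v (exact_solve (A J) b - v)"
    using is_E by auto
qed

text \<open>Subtracting the error equations of the two starting vectors eliminates the exact
  solution.\<close>

lemma vcycle_exact_diff:
  assumes b: "b \<in> carrier_vec (n J)" and v: "v \<in> carrier_vec (n J)" and w: "w \<in> carrier_vec (n J)"
  shows "vcycle A P M N (exact_solve (A 0)) J b v - vcycle A P M N (exact_solve (A 0)) J b w
    = error_propagation_matrix A P M N J *\<^sub>v (v - w)"
proof -
  let ?V = "vcycle A P M N (exact_solve (A 0)) J b" and ?u = "exact_solve (A J) b"
  let ?E = "error_propagation_matrix A P M N J"
  have u: "?u \<in> carrier_vec (n J)" by (rule exact_solve(1)[OF A_carrier[OF order_refl] A_spd b])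
  have V: "?V y \<in> carrier_vec (n J)" if "y \<in> carrier_vec (n J)" for y
    using vcycle_carrier[OF order_refl b that] exact_solve(1)[OF A_carrier spd_level] by simp
  have "?V v - ?V w = (?u - ?V w) - (?u - ?V v)"
    using u V[OF v] V[OF w] by (intro eq_vecI) auto
  also have "\<dots> = ?E *\<^sub>v (?u - w) - ?E *\<^sub>v (?u - v)"
    by (simp only: error_propagation_matrix(2)[OF b] v w)
  also have "\<dots> = ?E *\<^sub>v ((?u - w) - (?u - v))"
    using u v w by (intro mult_minus_distrib_mat_vec[symmetric, OF error_propagation_matrix(1)]) auto
  also have "(?u - w) - (?u - v) = v - w"
    using u v w by (intro eq_vecI) auto
  finally show ?thesis .
qed

lemma energy_norm_coarse_to_fine_le:
  assumes smoother: "\<And>j. j < J \<Longrightarrow>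
      convergent_smoother (A (Suc j)) (N (Suc j)) \<or> N (Suc j) = 0\<^sub>m (n (Suc j)) (n (Suc j))"
    and v: "v \<in> carrier_vec (n 0)"
  shows "j \<le> J \<Longrightarrow> energy_norm (A j) (coarse_to_fine A P N j *\<^sub>v v) \<le> energy_norm (A 0) v"
proof (induction j)
  case 0
  then show ?case using A_carrier[of 0] v by simp
next
  case (Suc j)
  then have j: "j < J" by simp
  note c = level_carriers[OF j]
  let ?A = "A (Suc j)"
  let ?I = "1\<^sub>m (n (Suc j)) - N (Suc j) * ?A"
  have S: "coarse_to_fine A P N j \<in> carrier_mat (n j) (n 0)" using coarse_to_fine_carrier j by simp
  then have Sv: "coarse_to_fine A P N j *\<^sub>v v \<in> carrier_vec (n j)" using v by simp
  have I: "?I \<in> carrier_mat (n (Suc j)) (n (Suc j))"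
    using c by (intro minus_carrier_mat mult_carrier_mat) auto
  have "coarse_to_fine A P N (Suc j) *\<^sub>v v = ?I *\<^sub>v (P (Suc j) *\<^sub>v (coarse_to_fine A P N j *\<^sub>v v))"
    using c(2,3) S I v by (simp add: mat_vec_assoc)
  then have "energy_norm ?A (coarse_to_fine A P N (Suc j) *\<^sub>v v)
    \<le> energy_norm ?A (P (Suc j) *\<^sub>v (coarse_to_fine A P N j *\<^sub>v v))"
    using smoother_nonexpansive[OF c(2) spd_level c(5) smoother] j mult_mat_vec_carrier[OF c(3) Sv] by simp
  also have "\<dots> = energy_norm (A j) (coarse_to_fine A P N j *\<^sub>v v)"
    by (rule energy_norm_prolong[OF j Sv])
  finally show ?case using Suc by simp
qed

lemma vcycle_iterate_carrier:
  assumes b: "b \<in> carrier_vec (n J)" and x0: "x0 \<in> carrier_vec (n J)"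
    and C: "\<And>k f. f \<in> carrier_vec (n 0) \<Longrightarrow> C k f \<in> carrier_vec (n 0)"
  shows "vcycle_iterate A P M N C J b x0 k \<in> carrier_vec (n J)"
  by (induction k) (auto intro: x0 vcycle_carrier[OF order_refl b] C)

end

section \<open>Accumulated effect of inexact coarsest-level solves\<close>

theorem theorem3p2:
  fixes J :: nat and n :: "nat \<Rightarrow> nat"
    and A P M N :: "nat \<Rightarrow> real mat"
    and b x x0 :: "real vec"
    and C :: "nat \<Rightarrow> real vec \<Rightarrow> real vec"
    and n_it :: nat and \<epsilon> :: real
    and E S :: "real mat"
    and x_ex x_in f0 v0 v0_in :: "nat \<Rightarrow> real vec"
  assumes J: "J \<ge> 1"
    and n_pos: "\<And>j. j \<le> J \<Longrightarrow> n j \<ge> 1"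
    and A_carrier: "\<And>j. j \<le> J \<Longrightarrow> A j \<in> carrier_mat (n j) (n j)"
    and A_spd: "spd (A J)"
    and P_carrier: "\<And>j. j \<in> {1..J} \<Longrightarrow> P j \<in> carrier_mat (n j) (n (j - 1))"
    and P_full_rank: "\<And>j. j \<in> {1..J} \<Longrightarrow> vec_space.rank (n j) (P j) = n (j - 1)"
    and galerkin: "\<And>j. j \<in> {1..J} \<Longrightarrow> A (j - 1) = transpose_mat (P j) * A j * P j"
    and M_carrier: "\<And>j. j \<in> {1..J} \<Longrightarrow> M j \<in> carrier_mat (n j) (n j)"
    and N_carrier: "\<And>j. j \<in> {1..J} \<Longrightarrow> N j \<in> carrier_mat (n j) (n j)"
    and smoothers:
      "(\<forall>j\<in>{1..J}. convergent_smoother (A j) (M j) \<and> convergent_smoother (A j) (N j)) \<or>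
       (\<forall>j\<in>{1..J}. M j = 0\<^sub>m (n j) (n j) \<and> convergent_smoother (A j) (N j)) \<or>
       (\<forall>j\<in>{1..J}. convergent_smoother (A j) (M j) \<and> N j = 0\<^sub>m (n j) (n j))"
    and b_carrier: "b \<in> carrier_vec (n J)"
    and x0_carrier: "x0 \<in> carrier_vec (n J)"
    and C_carrier: "\<And>k f. f \<in> carrier_vec (n 0) \<Longrightarrow> C k f \<in> carrier_vec (n 0)"
    and n_it: "n_it \<ge> 1"
    and eps: "\<epsilon> > 0"
  defines "x \<equiv> exact_solve (A J) b"
    and "E \<equiv> error_propagation_matrix A P M N J"
    and "S \<equiv> coarse_to_fine A P N J"
    and "x_ex \<equiv> exV_iterate A P M N J b x0"
    and "x_in \<equiv> vcycle_iterate A P M N C J b x0"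
    and "f0 \<equiv> \<lambda>k. coarsest_rhs A P M J b (x_in (k - 1))"
    and "v0 \<equiv> \<lambda>k. exact_solve (A 0) (f0 k)"
    and "v0_in \<equiv> \<lambda>k. C k (f0 k)"
  assumes E_contraction: "induced_norm (A J) (A J) E < 1"
    and coarse_error: "\<And>k. k \<in> {1..n_it} \<Longrightarrow> energy_norm (A 0) (v0 k - v0_in k) \<le> \<epsilon>"
  shows "energy_norm (A J) (x_ex n_it - x_in n_it)
           \<le> \<epsilon> * induced_norm (A 0) (A J) S / (1 - induced_norm (A J) (A J) E)
       \<and> induced_norm (A 0) (A J) S \<le> 1
       \<and> energy_norm (A J) (x - x_in n_it)
           \<le> energy_norm (A J) (x - x_ex n_it)
             + \<epsilon> * induced_norm (A 0) (A J) S / (1 - induced_norm (A J) (A J) E)"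
proof -
  interpret multigrid J n A P M N
  proof
    show "P (Suc j) \<in> carrier_mat (n (Suc j)) (n j)" if "j < J" for j
      using P_carrier[of "Suc j"] that by simp
    show "vec_space.rank (n (Suc j)) (P (Suc j)) = n j" if "j < J" for j
      using P_full_rank[of "Suc j"] that by simp
    show "A j = transpose_mat (P (Suc j)) * A (Suc j) * P (Suc j)" if "j < J" for j
      using galerkin[of "Suc j"] that by simp
  qed (use A_carrier A_spd M_carrier N_carrier in auto)
  have A0: "A 0 \<in> carrier_mat (n 0) (n 0)" "spd (A 0)" and AJ: "A J \<in> carrier_mat (n J) (n J)" "spd (A J)"
    using A_carrier spd_level by auto
  have n0: "n 0 \<ge> 1" and nJ: "n J \<ge> 1" using n_pos by auto
  have S: "S \<in> carrier_mat (n J) (n 0)" unfolding S_def by (rule coarse_to_fine_carrier) simp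
  have E: "E \<in> carrier_mat (n J) (n J)" unfolding E_def by (rule error_propagation_matrix(1))
  define e s where "e = induced_norm (A J) (A J) E" and "s = induced_norm (A 0) (A J) S"
  have e: "0 \<le> e" "e < 1" and s: "0 \<le> s"
    using induced_norm_nonneg[OF AJ AJ nJ E] induced_norm_nonneg[OF A0 AJ n0 S] E_contraction
    by (auto simp: e_def s_def)
  note exact_carrier = exact_solve(1)[OF A0]
  have x_ex: "x_ex k \<in> carrier_vec (n J)" and x_in: "x_in k \<in> carrier_vec (n J)" for k
    unfolding x_ex_def x_in_def exV_iterate_def
    using vcycle_iterate_carrier[OF b_carrier x0_carrier] exact_carrier C_carrier by auto
  have x: "x \<in> carrier_vec (n J)" unfolding x_def by (rule exact_solve(1)[OF AJ b_carrier])
  have f0: "f0 k \<in> carrier_vec (n 0)" for k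
    unfolding f0_def by (rule coarsest_rhs_carrier[OF order_refl b_carrier x_in])
  have step: "x_ex (Suc k) - x_in (Suc k) = E *\<^sub>v (x_ex k - x_in k) + S *\<^sub>v (v0 (Suc k) - v0_in (Suc k))" for k
  proof -
    let ?V = "\<lambda>C. vcycle A P M N C J b" and ?ex = "exact_solve (A 0)"
    have V: "?V ?ex (x_ex k) \<in> carrier_vec (n J)" "?V ?ex (x_in k) \<in> carrier_vec (n J)"
      "?V (C (Suc k)) (x_in k) \<in> carrier_vec (n J)"
      using vcycle_carrier[OF order_refl b_carrier] x_ex x_in exact_carrier C_carrier by auto
    have "x_ex (Suc k) - x_in (Suc k) = ?V ?ex (x_ex k) - ?V (C (Suc k)) (x_in k)"
      by (simp add: x_ex_def x_in_def exV_iterate_def)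
    also have "\<dots> = (?V ?ex (x_ex k) - ?V ?ex (x_in k)) + (?V ?ex (x_in k) - ?V (C (Suc k)) (x_in k))"
      using V by (intro eq_vecI) auto
    also have "?V ?ex (x_ex k) - ?V ?ex (x_in k) = E *\<^sub>v (x_ex k - x_in k)"
      unfolding E_def by (rule vcycle_exact_diff[OF b_carrier x_ex x_in])
    \<comment> \<open>Iterations are counted from 1, so \<open>f0 (Suc k)\<close> is the right-hand
      side arising from \<open>x_in k\<close>.\<close>
    also have "?V ?ex (x_in k) - ?V (C (Suc k)) (x_in k) = S *\<^sub>v (v0 (Suc k) - v0_in (Suc k))"
      using vcycle_diff[OF order_refl b_carrier x_in, of ?ex "C (Suc k)"] exact_carrier C_carrier
      by (simp add: S_def v0_def v0_in_def f0_def)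
    finally show ?thesis .
  qed
  \<comment> \<open>The limit of the geometric series is the fixed point of the map sending
    \<open>t\<close> to \<open>e * t + s * \<epsilon>\<close>. Since \<open>e\<close> is
    nonnegative, a bound by it passes from one iterate to the next, so no partial sums have to be
    written down.\<close>
  have bound: "k \<le> n_it \<Longrightarrow> energy_norm (A J) (x_ex k - x_in k) \<le> \<epsilon> * s / (1 - e)" for k
  proof (induction k)
    case 0
    have "x_ex 0 - x_in 0 = 0\<^sub>v (n J)"
      using x0_carrier by (simp add: x_ex_def x_in_def exV_iterate_def)
    then show ?case using energy_norm_zero[OF AJ] eps s e by simp
  next
    case (Suc k)
    have v0: "v0 (Suc k) - v0_in (Suc k) \<in> carrier_vec (n 0)"
      unfolding v0_def v0_in_def using exact_carrier C_carrier f0 by auto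
    have d: "x_ex k - x_in k \<in> carrier_vec (n J)" using x_ex x_in by simp
    have "energy_norm (A J) (x_ex (Suc k) - x_in (Suc k))
      \<le> energy_norm (A J) (E *\<^sub>v (x_ex k - x_in k)) + energy_norm (A J) (S *\<^sub>v (v0 (Suc k) - v0_in (Suc k)))"
      unfolding step by (intro energy_norm_triangle[OF AJ] mult_mat_vec_carrier[OF E d] mult_mat_vec_carrier[OF S v0])
    also have "\<dots> \<le> e * energy_norm (A J) (x_ex k - x_in k) + s * energy_norm (A 0) (v0 (Suc k) - v0_in (Suc k))"
      unfolding e_def s_def
      by (intro add_mono energy_norm_le_induced_norm[OF AJ AJ E d] energy_norm_le_induced_norm[OF A0 AJ S v0])
    also have "\<dots> \<le> e * (\<epsilon> * s / (1 - e)) + s * \<epsilon>"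
      using Suc coarse_error[of "Suc k"] e s by (intro add_mono mult_left_mono) auto
    also have "\<dots> = \<epsilon> * s / (1 - e)" using e by (simp add: field_simps)
    finally show ?case .
  qed
  have "s \<le> 1"
    unfolding s_def
  proof (rule induced_norm_le[OF A0 n0 S])
    \<comment> \<open>All three admissible choices of smoothers leave the post-smoothers either
      convergent or zero.\<close>
    have "convergent_smoother (A (Suc j)) (N (Suc j)) \<or> N (Suc j) = 0\<^sub>m (n (Suc j)) (n (Suc j))"
      if "j < J" for j
      using smoothers that by auto
    then show "energy_norm (A J) (S *\<^sub>v v) \<le> 1 * energy_norm (A 0) v" if "v \<in> carrier_vec (n 0)" for v
      unfolding S_def using energy_norm_coarse_to_fine_le[OF _ that order_refl] by simp
  qed
  moreover have "energy_norm (A J) (x - x_in n_it)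
      \<le> energy_norm (A J) (x - x_ex n_it) + energy_norm (A J) (x_ex n_it - x_in n_it)"
  proof -
    have "x - x_in n_it = (x - x_ex n_it) + (x_ex n_it - x_in n_it)"
      using x x_ex[of n_it] x_in[of n_it] by (intro eq_vecI) auto
    then show ?thesis
      using energy_norm_triangle[OF AJ, of "x - x_ex n_it" "x_ex n_it - x_in n_it"] x x_ex x_in by simp
  qed
  ultimately show ?thesis using bound[OF order_refl] by (simp add: e_def s_def)
qed

end
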